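(* Let $(u_k(t))_{k\in\mathbb{Z}}$, with values in $\mathbb{R}^m$, be a differentiable solution of the semidiscrete scheme $$\frac{\mathrm{d}u_k}{\mathrm{d}t}=\frac{f^{GT}_{\alpha_{k-\frac12}}(u_{k-1},u_k)-f^{GT}_{\alpha_{k+\frac12}}(u_k,u_{k+1})}{\Delta x},\qquad k\in\mathbb{Z},$$ where $\Delta x>0$ and $\alpha_{k+\frac12}\in[0,1]$ for every $k$ (the values $\alpha_{k+\frac12}$ may differ from one interface to another, and may depend on the solution). Then for every $k$ the semidiscrete cell entropy inequality $$\frac{\mathrm{d}\,U(u_k)}{\mathrm{d}t}\le\frac{F^{GT}_{\alpha_{k-\frac12}}(u_{k-1},u_k)-F^{GT}_{\alpha_{k+\frac12}}(u_k,u_{k+1})}{\Delta x}$$ holds with the numerical entropy flux $$F^{GT}_\alpha(u_l,u_r)=\alpha F^G(u_l,u_r)+(1-\alpha)F^T(u_l,u_r),$$ where $F^G(u_l,u_r)=F(u_R(0;u_l,u_r))$ and $$F^T(u_l,u_r)=\tfrac12\Big(\big\langle \tfrac{\partial U}{\partial u}(u_l)+\tfrac{\partial U}{\partial u}(u_r),\,f^T(u_l,u_r)\big\rangle+F(u_l)+F(u_r)-\big\langle\tfrac{\partial U}{\partial u}(u_l),f(u_l)\big\rangle-\big\langle\tfrac{\partial U}{\partial u}(u_r),f(u_r)\big\rangle\Big).$$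
   Context: Consider the system of conservation laws $\partial_t u+\partial_x f(u)=0$ with smooth $f:\mathbb{R}^m\to\mathbb{R}^m$, and an entropy pair $(U,F)$: smooth functions $U,F:\mathbb{R}^m\to\mathbb{R}$ with $U$ strictly convex (positive definite Hessian) and $\nabla F(u)^{T}=\nabla U(u)^{T}Df(u)$. The entropy variable is $v(u)=\frac{\partial U}{\partial u}(u)=\nabla U(u)$; the range of $u\mapsto v(u)$ is convex, and $v\mapsto u(v)$ denotes the inverse map. $\langle\cdot,\cdot\rangle$ is the Euclidean inner product on $\mathbb{R}^m$. Riemann solution: for all $u_l,u_r$ let $u_R(\xi;u_l,u_r)$ be the self-similar entropy solution of the Riemann problem. That is, $w(x,t)=u_R(x/t;u_l,u_r)$ is bounded, satisfies $\partial_t w+\partial_x f(w)=0$ and $\partial_t U(w)+\partial_x F(w)\le 0$ in the sense of distributions on $\mathbb{R}\times(0,\infty)$, equals $u_l$ for $x/t$ sufficiently negative and $u_r$ for $x/t$ sufficiently large, and $u_R(u,u)\equiv u$. It has one-sided limits in $\xi$, and $u_R(0;u_l,u_r)$ denotes its value at $\xi=0$, taken as a one-sided limit. Godunov flux: $f^G(u_l,u_r)=f(u_R(0;u_l,u_r))$. Tadmor's entropy conservative flux: $f^T(u_l,u_r)=\int_0^1 f\big(u(v_l+\xi(v_r-v_l))\big)\,\mathrm{d}\xi$ with $v_l=v(u_l)$, $v_r=v(u_r)$. Convex combination (GT) flux: for $\alpha\in[0,1]$, $f^{GT}_\alpha(u_l,u_r)=\alpha f^G(u_l,u_r)+(1-\alpha)f^T(u_l,u_r)$.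 *)

theory Defs
  imports "HOL-Analysis.Analysis"
begin

text \<open>\<open>k_smooth n g\<close>: all iterated directional derivatives of \<open>g\<close> of order at most \<open>n\<close> exist
  and are continuous, i.e. \<open>g\<close> is of class \<open>C\<^sup>n\<close>.\<close>

primrec k_smooth :: "nat \<Rightarrow> ('a::euclidean_space \<Rightarrow> 'b::euclidean_space) \<Rightarrow> bool" where
  "k_smooth 0 g \<longleftrightarrow> continuous_on UNIV g"
| "k_smooth (Suc n) g \<longleftrightarrow>
     (\<forall>x. g differentiable (at x)) \<and> (\<forall>h. k_smooth n (\<lambda>x. frechet_derivative g (at x) h))"

definition smooth :: "('a::euclidean_space \<Rightarrow> 'b::euclidean_space) \<Rightarrow> bool" where
  "smooth g \<longleftrightarrow> (\<forall>n. k_smooth n g)"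

definition grad :: "(real^'m \<Rightarrow> real) \<Rightarrow> real^'m \<Rightarrow> real^'m" where
  "grad g x = (\<chi> i. frechet_derivative g (at x) (axis i 1))"

definition hessian :: "(real^'m \<Rightarrow> real) \<Rightarrow> real^'m \<Rightarrow> real^'m^'m" where
  "hessian g x = jacobian (grad g) (at x)"

definition pos_def :: "real^'m^'m \<Rightarrow> bool" where
  "pos_def A \<longleftrightarrow> (\<forall>h. h \<noteq> 0 \<longrightarrow> 0 < h \<bullet> (A *v h))"

definition entropy_pair ::
  "(real^'m \<Rightarrow> real^'m) \<Rightarrow> (real^'m \<Rightarrow> real) \<Rightarrow> (real^'m \<Rightarrow> real) \<Rightarrow> bool" where
  "entropy_pair f U F \<longleftrightarrow>
     smooth U \<and> smooth F \<and> (\<forall>x. pos_def (hessian U x)) \<and>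
     (\<forall>x. grad F x = grad U x v* jacobian f (at x))"

abbreviation half_plane :: "(real \<times> real) set" where
  "half_plane \<equiv> UNIV \<times> {0<..}"

text \<open>Points of \<open>real \<times> real\<close> are pairs \<open>(x, t)\<close>, space first.\<close>

abbreviation dx :: "(real \<times> real \<Rightarrow> real) \<Rightarrow> real \<times> real \<Rightarrow> real" where
  "dx \<phi> p \<equiv> frechet_derivative \<phi> (at p) (1, 0)"

abbreviation dt :: "(real \<times> real \<Rightarrow> real) \<Rightarrow> real \<times> real \<Rightarrow> real" where
  "dt \<phi> p \<equiv> frechet_derivative \<phi> (at p) (0, 1)"

definition test_function :: "(real \<times> real \<Rightarrow> real) \<Rightarrow> bool" where
  "test_function \<phi> \<longleftrightarrow> smooth \<phi> \<and>
     compact (closure {p. \<phi> p \<noteq> 0}) \<and> closure {p. \<phi> p \<noteq> 0} \<subseteq> half_plane"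

text \<open>\<open>\<partial>\<^sub>t w + \<partial>\<^sub>x f(w) = 0\<close> and \<open>\<partial>\<^sub>t U(w) + \<partial>\<^sub>x F(w) \<le> 0\<close> as distributions on the open half-plane.
  Moving the derivatives onto the test function changes the sign, hence \<open>\<ge> 0\<close> below.
  Both definitions are meant for bounded measurable \<open>w\<close>.\<close>

definition weak_solution ::
  "(real^'m \<Rightarrow> real^'m) \<Rightarrow> (real \<times> real \<Rightarrow> real^'m) \<Rightarrow> bool" where
  "weak_solution f w \<longleftrightarrow> (\<forall>\<phi>. test_function \<phi> \<longrightarrow>
     (LINT p:half_plane|lborel. dt \<phi> p *\<^sub>R w p + dx \<phi> p *\<^sub>R f (w p)) = 0)"

definition weak_entropy_ineq ::
  "(real^'m \<Rightarrow> real) \<Rightarrow> (real^'m \<Rightarrow> real) \<Rightarrow> (real \<times> real \<Rightarrow> real^'m) \<Rightarrow> bool" where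
  "weak_entropy_ineq U F w \<longleftrightarrow> (\<forall>\<phi>. test_function \<phi> \<and> (\<forall>p. 0 \<le> \<phi> p) \<longrightarrow>
     (LINT p:half_plane|lborel. dt \<phi> p * U (w p) + dx \<phi> p * F (w p)) \<ge> 0)"

text \<open>\<open>uR \<xi> ul ur\<close> is the self-similar Riemann solution. The last clause says that \<open>uR 0 ul ur\<close> is one
  of the two one-sided limits at \<open>0\<close>; which one is left open and may depend on \<open>ul\<close> and \<open>ur\<close>.\<close>

definition riemann_solution ::
  "(real^'m \<Rightarrow> real^'m) \<Rightarrow> (real^'m \<Rightarrow> real) \<Rightarrow> (real^'m \<Rightarrow> real) \<Rightarrow>
   (real \<Rightarrow> real^'m \<Rightarrow> real^'m \<Rightarrow> real^'m) \<Rightarrow> bool" where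
  "riemann_solution f U F uR \<longleftrightarrow>
     (\<forall>u \<xi>. uR \<xi> u u = u) \<and>
     (\<forall>ul ur.
        bounded (range (\<lambda>\<xi>. uR \<xi> ul ur)) \<and>
        (\<lambda>\<xi>. uR \<xi> ul ur) \<in> borel_measurable borel \<and>
        weak_solution f (\<lambda>(x, t). uR (x / t) ul ur) \<and>
        weak_entropy_ineq U F (\<lambda>(x, t). uR (x / t) ul ur) \<and>
        (\<exists>M. (\<forall>\<xi>\<le>-M. uR \<xi> ul ur = ul) \<and> (\<forall>\<xi>\<ge>M. uR \<xi> ul ur = ur)) \<and>
        (\<forall>\<xi>. (\<exists>l. ((\<lambda>\<eta>. uR \<eta> ul ur) \<longlongrightarrow> l) (at_left \<xi>)) \<and>
              (\<exists>r. ((\<lambda>\<eta>. uR \<eta> ul ur) \<longlongrightarrow> r) (at_right \<xi>))) \<and>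
        (((\<lambda>\<eta>. uR \<eta> ul ur) \<longlongrightarrow> uR 0 ul ur) (at_left 0) \<or>
         ((\<lambda>\<eta>. uR \<eta> ul ur) \<longlongrightarrow> uR 0 ul ur) (at_right 0)))"

definition godunov_flux ::
  "(real^'m \<Rightarrow> real^'m) \<Rightarrow> (real \<Rightarrow> real^'m \<Rightarrow> real^'m \<Rightarrow> real^'m) \<Rightarrow>
   real^'m \<Rightarrow> real^'m \<Rightarrow> real^'m" where
  "godunov_flux f uR ul ur = f (uR 0 ul ur)"

text \<open>\<open>inv (grad U)\<close> is the map \<open>v \<mapsto> u(v)\<close> from entropy variables back to states.\<close>

definition tadmor_flux ::
  "(real^'m \<Rightarrow> real^'m) \<Rightarrow> (real^'m \<Rightarrow> real) \<Rightarrow> real^'m \<Rightarrow> real^'m \<Rightarrow> real^'m" where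
  "tadmor_flux f U ul ur =
     integral {0..1} (\<lambda>\<xi>. f (inv (grad U) (grad U ul + \<xi> *\<^sub>R (grad U ur - grad U ul))))"

definition gt_flux ::
  "(real^'m \<Rightarrow> real^'m) \<Rightarrow> (real^'m \<Rightarrow> real) \<Rightarrow> (real \<Rightarrow> real^'m \<Rightarrow> real^'m \<Rightarrow> real^'m) \<Rightarrow>
   real \<Rightarrow> real^'m \<Rightarrow> real^'m \<Rightarrow> real^'m" where
  "gt_flux f U uR a ul ur = a *\<^sub>R godunov_flux f uR ul ur + (1 - a) *\<^sub>R tadmor_flux f U ul ur"

definition godunov_entropy_flux ::
  "(real^'m \<Rightarrow> real) \<Rightarrow> (real \<Rightarrow> real^'m \<Rightarrow> real^'m \<Rightarrow> real^'m) \<Rightarrow>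
   real^'m \<Rightarrow> real^'m \<Rightarrow> real" where
  "godunov_entropy_flux F uR ul ur = F (uR 0 ul ur)"

definition tadmor_entropy_flux ::
  "(real^'m \<Rightarrow> real^'m) \<Rightarrow> (real^'m \<Rightarrow> real) \<Rightarrow> (real^'m \<Rightarrow> real) \<Rightarrow>
   real^'m \<Rightarrow> real^'m \<Rightarrow> real" where
  "tadmor_entropy_flux f U F ul ur =
     1 / 2 * ((grad U ul + grad U ur) \<bullet> tadmor_flux f U ul ur + F ul + F ur
              - grad U ul \<bullet> f ul - grad U ur \<bullet> f ur)"

definition gt_entropy_flux ::
  "(real^'m \<Rightarrow> real^'m) \<Rightarrow> (real^'m \<Rightarrow> real) \<Rightarrow> (real^'m \<Rightarrow> real) \<Rightarrow>
   (real \<Rightarrow> real^'m \<Rightarrow> real^'m \<Rightarrow> real^'m) \<Rightarrow> real \<Rightarrow> real^'m \<Rightarrow> real^'m \<Rightarrow> real" where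
  "gt_entropy_flux f U F uR a ul ur =
     a * godunov_entropy_flux F uR ul ur + (1 - a) * tadmor_entropy_flux f U F ul ur"

text \<open>\<open>u k t\<close> is the value in cell \<open>k\<close>; the interface \<open>k + 1/2\<close> between cells \<open>k\<close> and \<open>k + 1\<close> carries
  the index \<open>k\<close>, so \<open>\<alpha> k t\<close> is the weight \<open>\<alpha>\<^bsub>k+1/2\<^esub>\<close> at time \<open>t\<close>. An arbitrary dependence on \<open>t\<close> accommodates
  weights that depend on the solution.\<close>

definition gt_scheme_solution ::
  "(real^'m \<Rightarrow> real^'m) \<Rightarrow> (real^'m \<Rightarrow> real) \<Rightarrow> (real \<Rightarrow> real^'m \<Rightarrow> real^'m \<Rightarrow> real^'m) \<Rightarrow>
   real \<Rightarrow> (int \<Rightarrow> real \<Rightarrow> real) \<Rightarrow> real set \<Rightarrow> (int \<Rightarrow> real \<Rightarrow> real^'m) \<Rightarrow> bool" where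
  "gt_scheme_solution f U uR \<Delta> \<alpha> I u \<longleftrightarrow>
     (\<forall>k. \<forall>t\<in>I. (u k has_vector_derivative
        (gt_flux f U uR (\<alpha> (k - 1) t) (u (k - 1) t) (u k t)
         - gt_flux f U uR (\<alpha> k t) (u k t) (u (k + 1) t)) /\<^sub>R \<Delta>) (at t within I))"

end

theory Submission
  imports Defs "HOL-Computational_Algebra.Polynomial"
begin

text \<open>The entropy production of a cell splits into contributions of its two interfaces, so the whole
  question can be settled one interface at a time. Write \<open>\<psi>(u) = \<langle>\<nabla>U(u), f(u)\<rangle> - F(u)\<close> for the entropy
  potential, and let \<open>g\<close>, \<open>G\<close> be the numerical flux and entropy flux at an interface with states
  \<open>u\<^sub>l\<close>, \<open>u\<^sub>r\<close>. Suppose that \<open>\<psi>(u\<^sub>l) \<le> \<langle>\<nabla>U(u\<^sub>l), g\<rangle> - G\<close> and \<open>\<langle>\<nabla>U(u\<^sub>r), g\<rangle> - G \<le> \<psi>(u\<^sub>r)\<close> at every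
  interface (\<open>entropy_stable_interface\<close>). In a cell with state \<open>u\<close>, the second inequality at its left
  interface and the first one at its right interface enclose \<open>\<psi>(u)\<close>; the potential cancels and the cell
  entropy inequality remains. The condition is convex in \<open>(g, G)\<close>, so it passes from the Godunov
  and Tadmor fluxes to their combination, and the weights may vary arbitrarily between interfaces.

  For Tadmor's flux both inequalities are equalities. By the compatibility of \<open>U\<close> and \<open>F\<close>, the potential as a
  function of the entropy variables has gradient \<open>f\<close>; integrating along the segment from
  \<open>\<nabla>U(u\<^sub>l)\<close> to \<open>\<nabla>U(u\<^sub>r)\<close> gives \<open>\<langle>\<nabla>U(u\<^sub>r) - \<nabla>U(u\<^sub>l), f\<^sup>T\<rangle> = \<psi>(u\<^sub>r) - \<psi>(u\<^sub>l)\<close>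
  (\<open>tadmor_flux_entropy_conservative\<close>).

  For Godunov's flux, normalise the entropy at a state \<open>z\<close>: subtracting the tangent of \<open>U\<close> at \<open>z\<close> gives an
  entropy \<open>A\<close> that is nonnegative by convexity and vanishes at \<open>z\<close>, with an entropy flux \<open>B\<close> that
  vanishes at \<open>z\<close> as well. In terms of \<open>\<xi> = x/t\<close> the entropy inequality reads
  \<open>(B - \<xi> A)' + A \<le> 0\<close>. For \<open>z = u\<^sub>r\<close>, integrating it from \<open>0\<close> to a point beyond all waves
  gives \<open>B(u\<^sub>R(0)) \<ge> \<integral> A \<ge> 0\<close>, which is the inequality for \<open>u\<^sub>r\<close>; reflecting space gives the one
  for \<open>u\<^sub>l\<close>. The value \<open>u\<^sub>R(0)\<close> may be the limit from either side: the cut-off function only has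
  to switch on within a shrinking interval on that side of \<open>0\<close>, and the error is controlled because
  \<open>A\<close> is bounded (\<open>tensor_ineq_trace_nonneg\<close>). As the entropy
  inequality is given in the sense of distributions, this argument needs explicit smooth
  test functions; they are products of one-dimensional functions of \<open>x\<close> and of \<open>t\<close>, built from the
  flat function \<open>exp(-1/x)\<close>.\<close>

section \<open>Calculus of smooth functions\<close>

lemma k_smooth_SucI:
  assumes "\<And>x. (g has_derivative g' x) (at x)" and "\<And>h. k_smooth n (\<lambda>x. g' x h)"
  shows "k_smooth (Suc n) g"
proof -
  have "frechet_derivative g (at x) = g' x" for x
    using frechet_derivative_at[OF assms(1)] by simp
  then show ?thesis
    using assms by (auto simp: differentiable_def)
qed

lemma k_smooth_Suc_has_derivative:
  assumes "k_smooth (Suc n) g"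
  shows "(g has_derivative frechet_derivative g (at x)) (at x)"
  using assms frechet_derivative_works by auto

lemma k_smooth_continuous: "k_smooth n g \<Longrightarrow> continuous_on UNIV g"
  by (cases n) (auto intro!: differentiable_imp_continuous_on simp: differentiable_on_def
      intro: differentiable_at_withinI)

lemma k_smooth_SucD: "k_smooth (Suc n) g \<Longrightarrow> k_smooth n g"
proof (induction n arbitrary: g)
  case 0
  then show ?case using k_smooth_continuous[of "Suc 0" g] by simp
next
  case (Suc n)
  then show ?case by simp
qed

lemma k_smooth_const: "k_smooth n (\<lambda>x. c)"
proof (induction n arbitrary: c)
  case (Suc n)
  show ?case by (rule k_smooth_SucI[where g' = "\<lambda>x h. 0"]) (auto intro: Suc)
qed simp

lemma k_smooth_add:
  "k_smooth n f \<Longrightarrow> k_smooth n g \<Longrightarrow> k_smooth n (\<lambda>x. f x + g x)"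
proof (induction n arbitrary: f g)
  case (Suc n)
  show ?case
    by (rule k_smooth_SucI[OF has_derivative_add[OF k_smooth_Suc_has_derivative[OF Suc.prems(1)]
            k_smooth_Suc_has_derivative[OF Suc.prems(2)]]])
      (use Suc in auto)
qed (auto intro: continuous_on_add)

lemma k_smooth_mult:
  fixes f g :: "'a::euclidean_space \<Rightarrow> real"
  shows "k_smooth n f \<Longrightarrow> k_smooth n g \<Longrightarrow> k_smooth n (\<lambda>x. f x * g x)"
proof (induction n arbitrary: f g)
  case (Suc n)
  show ?case
    by (rule k_smooth_SucI[OF has_derivative_mult[OF k_smooth_Suc_has_derivative[OF Suc.prems(1)]
            k_smooth_Suc_has_derivative[OF Suc.prems(2)]]])
      (use Suc k_smooth_SucD[OF Suc.prems(1)] k_smooth_SucD[OF Suc.prems(2)]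
       in \<open>auto intro!: k_smooth_add\<close>)
qed (auto intro: continuous_on_mult)

text \<open>Translations, dilations, reflections and the coordinate projections of the plane
  are all affine, so this is the only form of the chain rule that the test functions require.\<close>

lemma k_smooth_affine:
  assumes "bounded_linear L"
  shows "k_smooth n g \<Longrightarrow> k_smooth n (\<lambda>x. g (L x + c))"
proof (induction n arbitrary: g)
  case 0
  have "continuous_on UNIV (\<lambda>x. L x + c)"
    by (intro continuous_intros bounded_linear.continuous_on[OF assms])
  then show ?case
    using 0 continuous_on_compose2[of UNIV g UNIV "\<lambda>x. L x + c"] by auto
next
  case (Suc n)
  have L: "((\<lambda>x. L x + c) has_derivative L) (at x)" for x
    by (auto intro!: derivative_eq_intros bounded_linear_imp_has_derivative assms)
  have "((\<lambda>x. g (L x + c)) has_derivative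
      (\<lambda>h. frechet_derivative g (at (L x + c)) (L h))) (at x)" for x
    using has_derivative_compose[OF L k_smooth_Suc_has_derivative[OF Suc.prems]] .
  then show ?case
    by (rule k_smooth_SucI) (use Suc in auto)
qed

lemma smooth_antiderivative:
  fixes G g :: "real \<Rightarrow> real"
  assumes "\<And>x. (G has_real_derivative g x) (at x)" and "smooth g"
  shows "smooth G"
  unfolding smooth_def
proof
  fix n
  have "k_smooth (Suc n) G"
  proof (rule k_smooth_SucI)
    show "(G has_derivative (*) (g x)) (at x)" for x
      using assms(1) by (simp add: has_field_derivative_def)
    show "k_smooth n (\<lambda>x. g x * h)" for h
      using assms(2) by (auto simp: smooth_def intro!: k_smooth_mult k_smooth_const)
  qed
  then show "k_smooth n G" by (rule k_smooth_SucD)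
qed

lemma smooth_mult:
  fixes f g :: "'a::euclidean_space \<Rightarrow> real"
  shows "smooth f \<Longrightarrow> smooth g \<Longrightarrow> smooth (\<lambda>x. f x * g x)"
  by (simp add: smooth_def k_smooth_mult)

lemma smooth_add: "smooth f \<Longrightarrow> smooth g \<Longrightarrow> smooth (\<lambda>x. f x + g x)"
  by (simp add: smooth_def k_smooth_add)

lemma smooth_const: "smooth (\<lambda>x. c)"
  by (simp add: smooth_def k_smooth_const)

lemma smooth_affine: "bounded_linear L \<Longrightarrow> smooth g \<Longrightarrow> smooth (\<lambda>x. g (L x + c))"
  by (simp add: smooth_def k_smooth_affine)

lemma smooth_has_derivative:
  "smooth g \<Longrightarrow> (g has_derivative frechet_derivative g (at x)) (at x)"
  using k_smooth_Suc_has_derivative unfolding smooth_def by blast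

lemma smooth_continuous: "smooth g \<Longrightarrow> continuous_on UNIV g"
  using k_smooth_continuous unfolding smooth_def by blast

lemma smooth_frechet_derivative: "smooth g \<Longrightarrow> smooth (\<lambda>x. frechet_derivative g (at x) h)"
  unfolding smooth_def by (metis k_smooth.simps(2))

lemma smooth_DERIV:
  fixes g :: "real \<Rightarrow> real"
  assumes "smooth g"
  shows "(g has_real_derivative frechet_derivative g (at x) 1) (at x)"
proof (rule has_derivative_imp_has_field_derivative[OF smooth_has_derivative[OF assms]])
  interpret L: bounded_linear "frechet_derivative g (at x)"
    using smooth_has_derivative[OF assms] by (rule has_derivative_bounded_linear)
  show "h * frechet_derivative g (at x) 1 = frechet_derivative g (at x) h" for h
    using L.scaleR[of h 1] by simp
qed

lemma smooth_DERIV_continuous: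
  fixes g g' :: "real \<Rightarrow> real"
  assumes "smooth g" and "\<And>x. (g has_real_derivative g' x) (at x)"
  shows "continuous_on S g'"
proof -
  have "frechet_derivative g (at x) 1 = g' x" for x
    using frechet_derivative_at[OF assms(2)[unfolded has_field_derivative_def]] by (metis mult.right_neutral)
  then show ?thesis
    using smooth_continuous[OF smooth_frechet_derivative[OF assms(1)], of 1]
    by (auto intro: continuous_on_subset)
qed

text \<open>The functions \<open>p(1/x) exp(-1/x)\<close>, for all polynomials \<open>p\<close> at once: unlike the single function
  \<open>exp(-1/x)\<close>, this family is closed under differentiation, so that smoothness follows by induction.\<close>

definition flat_exp :: "real poly \<Rightarrow> real \<Rightarrow> real" where
  "flat_exp p x = (if x > 0 then poly p (1 / x) * exp (- 1 / x) else 0)"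

lemma poly_times_exp_tendsto_0:
  fixes p :: "real poly"
  shows "((\<lambda>y. poly p y * exp (- y)) \<longlongrightarrow> 0) at_top"
proof -
  have "((\<lambda>y. coeff p i * (y ^ i / exp y)) \<longlongrightarrow> coeff p i * 0) at_top" for i
    by (intro tendsto_mult tendsto_const tendsto_power_div_exp_0)
  then have "((\<lambda>y. \<Sum>i\<le>degree p. coeff p i * (y ^ i / exp y)) \<longlongrightarrow> 0) at_top"
    by (intro tendsto_null_sum) simp
  then show ?thesis
    by (simp add: poly_altdef exp_minus field_simps sum_divide_distrib sum_distrib_right)
qed

lemma flat_exp_tendsto_0: "((flat_exp p) \<longlongrightarrow> 0) (at 0)"
proof (rule filterlim_split_at)
  show "(flat_exp p \<longlongrightarrow> 0) (at_left 0)"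
    by (rule tendsto_eventually) (auto simp: flat_exp_def eventually_at_filter)
  have "((\<lambda>x. poly p (inverse x) * exp (- inverse x)) \<longlongrightarrow> 0) (at_right (0::real))"
    by (rule filterlim_compose[OF poly_times_exp_tendsto_0 filterlim_inverse_at_top_right])
  then show "(flat_exp p \<longlongrightarrow> 0) (at_right 0)"
    by (rule Lim_transform_eventually)
      (auto simp: flat_exp_def eventually_at_filter inverse_eq_divide)
qed

text \<open>With \<open>y = 1/x\<close>, the chain rule contributes the factor \<open>y\<^sup>2\<close> to the derivative
  \<open>y\<^sup>2 (p - p')(y) exp(-y)\<close>. At \<open>0\<close> the difference quotient is the family member for \<open>y p(y)\<close>, which tends to \<open>0\<close>.\<close>

lemma flat_exp_derivative:
  "(flat_exp p has_real_derivative flat_exp (monom 1 2 * (p - pderiv p)) x) (at x)"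
proof -
  consider "x > 0" | "x < 0" | "x = 0" by linarith
  then show ?thesis
  proof cases
    case 1
    have "((\<lambda>x. poly p (1 / x) * exp (- 1 / x)) has_real_derivative
        flat_exp (monom 1 2 * (p - pderiv p)) x) (at x)"
      using 1 by (auto simp: flat_exp_def poly_monom power2_eq_square field_simps
          intro!: derivative_eq_intros DERIV_chain2[OF poly_DERIV])
    moreover have "\<forall>\<^sub>F y in nhds x. y \<in> {0<..}"
      using 1 by (intro eventually_nhds_in_open) auto
    then have "\<forall>\<^sub>F y in nhds x. flat_exp p y = poly p (1 / y) * exp (- 1 / y)"
      by (rule eventually_mono) (auto simp: flat_exp_def)
    ultimately show ?thesis
      by (subst DERIV_cong_ev[OF refl _ refl]) auto
  next
    case 2
    have "\<forall>\<^sub>F y in nhds x. y \<in> {..<0}"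
      using 2 by (intro eventually_nhds_in_open) auto
    then have "\<forall>\<^sub>F y in nhds x. flat_exp p y = 0"
      by (rule eventually_mono) (auto simp: flat_exp_def)
    then show ?thesis
      using 2 by (subst DERIV_cong_ev[OF refl _ refl]) (auto simp: flat_exp_def)
  next
    case 3
    have "((\<lambda>y. flat_exp (monom 1 1 * p) y) \<longlongrightarrow> 0) (at 0)"
      by (rule flat_exp_tendsto_0)
    then have "((\<lambda>y. (flat_exp p y - flat_exp p 0) / (y - 0)) \<longlongrightarrow> 0) (at 0)"
      by (rule Lim_transform_eventually)
        (auto simp: flat_exp_def eventually_at_filter poly_monom field_simps)
    then show ?thesis
      using 3 by (simp add: has_field_derivative_iff flat_exp_def)
  qed
qed

lemma smooth_flat_exp: "smooth (flat_exp p)"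
  unfolding smooth_def
proof
  fix n show "k_smooth n (flat_exp p)"
  proof (induction n arbitrary: p)
    case 0
    show ?case
      using DERIV_isCont[OF flat_exp_derivative] by (simp add: continuous_on_eq_continuous_at)
  next
    case (Suc n)
    show ?case
    proof (rule k_smooth_SucI)
      show "(flat_exp p has_derivative (*) (flat_exp (monom 1 2 * (p - pderiv p)) x)) (at x)" for x
        using flat_exp_derivative by (simp add: has_field_derivative_def)
    qed (intro k_smooth_mult k_smooth_const Suc)
  qed
qed

text \<open>The bump \<open>\<beta>\<close> has total mass 1, encoded by its antiderivative, the smooth step \<open>B\<close>. Both
  are used: \<open>\<beta>\<close> as cut-off in time and approximate delta in space, \<open>B\<close> as cut-off in space.\<close>

lemma bump_exists:
  "\<exists>\<beta> B :: real \<Rightarrow> real. smooth \<beta> \<and> (\<forall>x. 0 \<le> \<beta> x) \<and> (\<forall>x. x \<notin> {0<..<1} \<longrightarrow> \<beta> x = 0) \<and>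
    (\<forall>x. (B has_real_derivative \<beta> x) (at x)) \<and> (\<forall>x\<le>0. B x = 0) \<and> (\<forall>x\<ge>1. B x = 1)"
proof -
  define b where "b x = flat_exp 1 x * flat_exp 1 (1 - x)" for x
  have "smooth (\<lambda>x. flat_exp 1 (- x + 1))"
    by (rule smooth_affine[OF _ smooth_flat_exp]) (rule bounded_linear_minus[OF bounded_linear_ident])
  then have b: "smooth b"
    unfolding b_def by (intro smooth_mult smooth_flat_exp) simp
  have b0: "b x \<ge> 0" "x \<notin> {0<..<1} \<Longrightarrow> b x = 0" "x \<in> {0<..<1} \<Longrightarrow> b x > 0" for x
    by (auto simp: b_def flat_exp_def)
  have cb: "continuous_on S b" for S
    using smooth_continuous[OF b] continuous_on_subset by blast
  \<comment> \<open>Starting the integral at \<open>-1\<close> makes \<open>0\<close> an interior point, so that the fundamental theorem of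
    calculus gives a two-sided derivative there.\<close>
  define A where "A x = integral {-1..x} b" for x
  have A0: "A x = 0" if "x \<le> 0" for x
    unfolding A_def using that
    by (subst Henstock_Kurzweil_Integration.integral_cong[where g = "\<lambda>_. 0"]) (auto intro: b0)
  have dA: "(A has_real_derivative b x) (at x)" for x
  proof (cases "x < 0")
    case True
    have "\<forall>\<^sub>F y in nhds x. y \<in> {..<0}"
      using True by (intro eventually_nhds_in_open) auto
    then have "\<forall>\<^sub>F y in nhds x. A y = 0"
      by (rule eventually_mono) (auto simp: A0)
    then show ?thesis
      using True b0(2)[of x] by (subst DERIV_cong_ev[OF refl _ refl]) auto
  next
    case False
    have "(A has_real_derivative b x) (at x within {-1..x+1})"
      unfolding A_def by (rule integral_has_real_derivative) (use cb False in auto)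
    then show ?thesis
      using False by (subst (asm) at_within_Icc_at) auto
  qed
  have A1: "A x = A 1" if "x \<ge> 1" for x
  proof -
    have "A x = integral {-1..1} b + integral {1..x} b"
      unfolding A_def using that
      by (intro Henstock_Kurzweil_Integration.integral_combine[symmetric] integrable_continuous_real cb) auto
    also have "integral {1..x} b = 0"
      by (subst Henstock_Kurzweil_Integration.integral_cong[where g = "\<lambda>_. 0"]) (auto intro: b0)
    finally show ?thesis by (simp add: A_def)
  qed
  \<comment> \<open>The total mass is positive, so that the bump can be normalised.\<close>
  have "A (1/2) > A (1/4)"
    by (rule DERIV_pos_imp_increasing) (auto intro!: exI[of _ "b _"] dA b0)
  moreover have "A x \<le> A y" if "x \<le> y" for x y
    using that by (intro DERIV_nonneg_imp_nondecreasing[of x y A]) (auto intro!: exI[of _ "b _"] dA b0)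
  from this[of 0 "1/4"] this[of "1/2" 1] have "A (1/2) \<le> A 1" "0 \<le> A (1/4)" using A0[of 0] by auto
  ultimately have Ap: "A 1 > 0" by linarith
  show ?thesis
  proof (rule exI[of _ "\<lambda>x. b x * (1 / A 1)"], rule exI[of _ "\<lambda>x. A x * (1 / A 1)"],
      intro conjI allI impI)
    show "smooth (\<lambda>x. b x * (1 / A 1))" by (intro smooth_mult smooth_const b)
    show "((\<lambda>x. A x * (1 / A 1)) has_real_derivative b x * (1 / A 1)) (at x)" for x
      by (rule DERIV_cmult_right[OF dA])
    show "A x * (1 / A 1) = 1" if "x \<ge> 1" for x
      using Ap A1[OF that] by simp
  qed (use Ap A0 b0 in auto)
qed

section \<open>Entropy variables and Tadmor's flux\<close>

lemma smooth_has_derivative_grad: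
  fixes g :: "real^'m \<Rightarrow> real"
  assumes "smooth g"
  shows "(g has_derivative (\<lambda>h. grad g x \<bullet> h)) (at x)"
proof -
  note d = smooth_has_derivative[OF assms, of x]
  interpret D: bounded_linear "frechet_derivative g (at x)"
    using d by (rule has_derivative_bounded_linear)
  have "frechet_derivative g (at x) h = grad g x \<bullet> h" for h
  proof -
    have "frechet_derivative g (at x) h
        = frechet_derivative g (at x) (\<Sum>i\<in>UNIV. h $ i *\<^sub>R axis i 1)"
      using basis_expansion[of h] by (simp add: scalar_mult_eq_scaleR)
    also have "\<dots> = grad g x \<bullet> h"
      by (simp add: D.sum D.scaleR grad_def inner_vec_def mult.commute)
    finally show ?thesis .
  qed
  then have "frechet_derivative g (at x) = (\<lambda>h. grad g x \<bullet> h)" by blast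
  then show ?thesis
    using d by simp
qed

lemma smooth_grad_has_derivative_hessian:
  fixes g :: "real^'m \<Rightarrow> real"
  assumes "smooth g"
  shows "(grad g has_derivative (\<lambda>h. hessian g x *v h)) (at x)"
proof -
  have "(\<lambda>x. grad g x \<bullet> i) differentiable (at x)" if i: "i \<in> Basis" for i
  proof -
    obtain j where "i = axis j 1" using i by (auto simp: Basis_vec_def)
    then have "(\<lambda>x. grad g x \<bullet> i) = (\<lambda>x. frechet_derivative g (at x) (axis j 1))"
      by (simp add: grad_def inner_axis)
    then show ?thesis
      using smooth_has_derivative[OF smooth_frechet_derivative[OF assms]]
      by (auto simp: differentiable_def)
  qed
  then have "grad g differentiable (at x)"
    by (subst differentiable_componentwise_within) auto
  then show ?thesis
    unfolding hessian_def by (simp add: jacobian_works)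
qed

text \<open>Along the segment from \<open>a\<close> to \<open>b\<close> the directional derivative of \<open>U\<close> is strictly
  increasing, its derivative being the Hessian form. Both the injectivity of the entropy variables and the
  convexity inequality follow from this.\<close>

lemma grad_strict_mono:
  fixes U :: "real^'m \<Rightarrow> real"
  assumes U: "smooth U" and pd: "\<And>x. pos_def (hessian U x)" and "a \<noteq> b"
  shows "0 < (grad U b - grad U a) \<bullet> (b - a)"
proof -
  define d where "d = b - a"
  have line: "((\<lambda>s. a + s *\<^sub>R d) has_derivative (\<lambda>h. h *\<^sub>R d)) (at s)" for s :: real
    by (auto intro!: derivative_eq_intros)
  have "((\<lambda>s. grad U (a + s *\<^sub>R d) \<bullet> d) has_real_derivative (hessian U (a + s *\<^sub>R d) *v d) \<bullet> d) (at s)"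
    for s :: real
    unfolding has_field_derivative_def
    by (rule has_derivative_eq_rhs[OF has_derivative_inner_left[OF has_derivative_compose
            [OF line smooth_grad_has_derivative_hessian[OF U]]]])
      (simp add: fun_eq_iff matrix_vector_mult_scaleR)
  moreover have "0 < (hessian U (a + s *\<^sub>R d) *v d) \<bullet> d" for s :: real
    using pd assms(3) by (simp add: pos_def_def d_def inner_commute)
  ultimately have "grad U (a + 0 *\<^sub>R d) \<bullet> d < grad U (a + 1 *\<^sub>R d) \<bullet> d"
    by (intro DERIV_pos_imp_increasing[where f = "\<lambda>s. grad U (a + s *\<^sub>R d) \<bullet> d"]) auto
  then show ?thesis by (simp add: d_def inner_diff_left)
qed

lemma grad_inj:
  assumes "smooth U" and "\<And>x. pos_def (hessian U x)"
  shows "inj (grad U)"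
  using grad_strict_mono[OF assms] by (force intro: injI)

lemma convex_tangent_below:
  fixes U :: "real^'m \<Rightarrow> real"
  assumes U: "smooth U" and pd: "\<And>x. pos_def (hessian U x)"
  shows "U a + grad U a \<bullet> (b - a) \<le> U b"
proof -
  define d where "d = b - a"
  have line: "((\<lambda>s. a + s *\<^sub>R d) has_derivative (\<lambda>h. h *\<^sub>R d)) (at s)" for s :: real
    by (auto intro!: derivative_eq_intros)
  have "((\<lambda>s. U (a + s *\<^sub>R d)) has_real_derivative grad U (a + s *\<^sub>R d) \<bullet> d) (at s)" for s :: real
    unfolding has_field_derivative_def
    by (rule has_derivative_eq_rhs[OF has_derivative_compose[OF line smooth_has_derivative_grad[OF U]]])
      (simp add: fun_eq_iff)
  from MVT2[OF zero_less_one this] obtain s where s: "0 < s" "s < 1"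
    and eq: "U (a + d) - U a = grad U (a + s *\<^sub>R d) \<bullet> d" by auto
  have "0 \<le> (grad U (a + s *\<^sub>R d) - grad U a) \<bullet> (s *\<^sub>R d)"
    using grad_strict_mono[OF U pd, of a "a + s *\<^sub>R d"] by (cases "s *\<^sub>R d = 0") auto
  then have "0 \<le> (grad U (a + s *\<^sub>R d) - grad U a) \<bullet> d"
    using s by (simp add: zero_le_mult_iff)
  then show ?thesis
    using eq by (simp add: d_def inner_diff_left)
qed

definition entropy_potential ::
  "(real^'m \<Rightarrow> real^'m) \<Rightarrow> (real^'m \<Rightarrow> real) \<Rightarrow> (real^'m \<Rightarrow> real) \<Rightarrow> real^'m \<Rightarrow> real" where
  "entropy_potential f U F u = grad U u \<bullet> f u - F u"

text \<open>The terms \<open>\<langle>\<nabla>U, Df h\<rangle>\<close> and \<open>\<langle>\<nabla>F, h\<rangle>\<close> cancel by compatibility. What is left says that, with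
  respect to the entropy variables \<open>v = \<nabla>U(u)\<close>, the gradient of the potential is \<open>f\<close>.\<close>

lemma entropy_potential_has_derivative:
  assumes f: "smooth f" and ep: "entropy_pair f U F"
  shows "(entropy_potential f U F has_derivative (\<lambda>h. (hessian U x *v h) \<bullet> f x)) (at x)"
proof -
  have U: "smooth U" and F: "smooth F" and comp: "grad F x = grad U x v* jacobian f (at x)"
    using ep by (auto simp: entropy_pair_def)
  have "f differentiable (at x)"
    using smooth_has_derivative[OF f] by (auto simp: differentiable_def)
  then have df: "(f has_derivative (\<lambda>h. jacobian f (at x) *v h)) (at x)"
    by (simp add: jacobian_works)
  show ?thesis
    unfolding entropy_potential_def [abs_def]
    by (rule has_derivative_eq_rhs, rule has_derivative_diff[OF has_derivative_inner
          [OF smooth_grad_has_derivative_hessian[OF U] df] smooth_has_derivative_grad[OF F]])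
      (simp add: comp dot_lmul_matrix)
qed

text \<open>Since \<open>\<nabla>U\<close> is injective, the inverse function theorem applies to the global inverse.\<close>

lemma inv_grad_has_derivative:
  fixes U :: "real^'m \<Rightarrow> real"
  assumes U: "smooth U" and pd: "\<And>x. pos_def (hessian U x)"
  obtains g' where "(inv (grad U) has_derivative g') (at (grad U x))"
    and "\<And>h. hessian U x *v g' h = h"
proof -
  have "hessian U x *v h = 0 \<Longrightarrow> h = 0" for h
    using pd[of x] by (auto simp: pos_def_def)
  then have "inj ((*v) (hessian U x))"
    by (simp add: linear_injective_0)
  then obtain g' where g': "\<And>h. hessian U x *v g' h = h"
    using linear_injective_isomorphism[OF matrix_vector_mul_linear, of "hessian U x"] by auto
  have "(inv (grad U) has_derivative g') (at (grad U x))"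
  proof (rule has_derivative_inverse_strong[where S = UNIV and f = "grad U" and f' = "\<lambda>h. hessian U x *v h"])
    show "continuous_on UNIV (grad U)"
      using smooth_grad_has_derivative_hessian[OF U]
      by (meson continuous_at_imp_continuous_on has_derivative_continuous)
    show "inv (grad U) (grad U y) = y" for y
      using grad_inj[OF U pd] by simp
    show "(grad U has_derivative (\<lambda>h. hessian U x *v h)) (at x)"
      by (rule smooth_grad_has_derivative_hessian[OF U])
    show "(\<lambda>h. hessian U x *v h) \<circ> g' = id"
      using g' by (simp add: fun_eq_iff)
  qed auto
  with g' show ?thesis by (intro that)
qed

text \<open>Fundamental theorem of calculus for the potential along the curve \<open>p\<close> whose entropy variables
  run through the segment from \<open>\<nabla>U(u\<^sub>l)\<close> to \<open>\<nabla>U(u\<^sub>r)\<close>. Convexity of the range keeps the segment in the domain of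
  the inverse map.\<close>

lemma tadmor_flux_entropy_conservative:
  fixes f :: "real^'m \<Rightarrow> real^'m"
  assumes f: "smooth f" and ep: "entropy_pair f U F" and conv: "convex (range (grad U))"
  shows "(grad U ur - grad U ul) \<bullet> tadmor_flux f U ul ur
    = entropy_potential f U F ur - entropy_potential f U F ul"
proof -
  have U: "smooth U" and pd: "\<And>x. pos_def (hessian U x)"
    using ep by (auto simp: entropy_pair_def)
  define d where "d = grad U ur - grad U ul"
  define v where "v s = grad U ul + s *\<^sub>R d" for s :: real
  define p where "p s = inv (grad U) (v s)" for s
  have inv: "inv (grad U) (grad U y) = y" for y
    using grad_inj[OF U pd] by simp
  have v: "grad U (p s) = v s" if "s \<in> {0..1}" for s
  proof -
    have "v s = (1 - s) *\<^sub>R grad U ul + s *\<^sub>R grad U ur"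
      by (simp add: v_def d_def algebra_simps)
    then have "v s \<in> range (grad U)"
      using that by (auto intro!: convexD[OF conv])
    then show ?thesis unfolding p_def by (rule f_inv_into_f)
  qed
  have deriv: "\<exists>p'. (p has_derivative p') (at s) \<and> (\<forall>h. hessian U (p s) *v p' h = h *\<^sub>R d)"
    if s: "s \<in> {0..1}" for s
  proof -
    obtain g' where g': "(inv (grad U) has_derivative g') (at (v s))"
      "\<And>h. hessian U (p s) *v g' h = h"
      using inv_grad_has_derivative[OF U pd, of "p s"] v[OF s] by metis
    have "(v has_derivative (\<lambda>h. h *\<^sub>R d)) (at s)"
      unfolding v_def [abs_def] by (auto intro!: derivative_eq_intros)
    from has_derivative_compose[OF this g'(1)] g'(2) show ?thesis
      unfolding p_def [abs_def] by blast
  qed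
  have cont: "continuous_on {0..1} (\<lambda>s. f (p s))"
  proof (rule continuous_on_compose2[of UNIV f])
    show "continuous_on {0..1} p"
      using deriv by (meson continuous_at_imp_continuous_on has_derivative_continuous)
  qed (use smooth_continuous[OF f] in auto)
  have "((\<lambda>s. entropy_potential f U F (p s)) has_vector_derivative d \<bullet> f (p s)) (at s within {0..1})"
    if s: "s \<in> {0..1}" for s
  proof -
    obtain p' where p': "(p has_derivative p') (at s)" "\<And>h. hessian U (p s) *v p' h = h *\<^sub>R d"
      using deriv[OF s] by blast
    show ?thesis
      using has_derivative_compose[OF p'(1) entropy_potential_has_derivative[OF f ep]]
      by (simp add: p'(2) has_vector_derivative_def has_derivative_at_withinI)
  qed
  then have "((\<lambda>s. d \<bullet> f (p s)) has_integral
      entropy_potential f U F (p 1) - entropy_potential f U F (p 0)) {0..1}"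
    by (intro fundamental_theorem_of_calculus) auto
  moreover have "((\<lambda>s. d \<bullet> f (p s)) has_integral d \<bullet> integral {0..1} (\<lambda>s. f (p s))) {0..1}"
    using has_integral_linear[OF integrable_integral[OF integrable_continuous_real[OF cont]]
        bounded_linear_inner_right[of d]]
    by (simp add: o_def)
  moreover have "p 0 = ul" "p 1 = ur"
    by (auto simp: p_def v_def d_def inv)
  ultimately show ?thesis
    unfolding tadmor_flux_def d_def[symmetric] v_def[symmetric] p_def[symmetric]
    by (simp add: has_integral_unique)
qed

section \<open>Entropy stability at one interface\<close>

text \<open>The part of the cell entropy inequality that one interface is responsible for. Summing the
  two conditions gives Tadmor's condition \<open>\<langle>\<nabla>U(u\<^sub>r) - \<nabla>U(u\<^sub>l), g\<rangle> \<le> \<psi>(u\<^sub>r) - \<psi>(u\<^sub>l)\<close>; keeping them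
  apart also ties \<open>G\<close> to \<open>g\<close>.\<close>

definition entropy_stable_interface ::
  "(real^'m \<Rightarrow> real^'m) \<Rightarrow> (real^'m \<Rightarrow> real) \<Rightarrow> (real^'m \<Rightarrow> real) \<Rightarrow>
   real^'m \<Rightarrow> real^'m \<Rightarrow> real^'m \<Rightarrow> real \<Rightarrow> bool" where
  "entropy_stable_interface f U F ul ur g G \<longleftrightarrow>
     entropy_potential f U F ul \<le> grad U ul \<bullet> g - G \<and>
     grad U ur \<bullet> g - G \<le> entropy_potential f U F ur"

text \<open>The entropy flux is the average that makes the two conditions symmetric; as the flux conserves
  entropy, both hold with equality.\<close>

lemma tadmor_stable:
  fixes f :: "real^'m \<Rightarrow> real^'m"
  assumes "smooth f" and "entropy_pair f U F" and "convex (range (grad U))"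
  shows "entropy_stable_interface f U F ul ur (tadmor_flux f U ul ur) (tadmor_entropy_flux f U F ul ur)"
  using tadmor_flux_entropy_conservative[OF assms, of ur ul]
  by (simp add: entropy_stable_interface_def tadmor_entropy_flux_def entropy_potential_def
      inner_diff_left inner_add_left field_simps)

lemma entropy_stable_interface_convex_combination:
  assumes "entropy_stable_interface f U F ul ur g1 G1" "entropy_stable_interface f U F ul ur g2 G2"
    and "a \<in> {0..1}"
  shows "entropy_stable_interface f U F ul ur (a *\<^sub>R g1 + (1 - a) *\<^sub>R g2) (a * G1 + (1 - a) * G2)"
proof -
  have comb: "v \<bullet> (a *\<^sub>R g1 + (1 - a) *\<^sub>R g2) - (a * G1 + (1 - a) * G2)
      = a * (v \<bullet> g1 - G1) + (1 - a) * (v \<bullet> g2 - G2)" for v :: "real^'a"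
    by (simp add: inner_add_right algebra_simps)
  have "p \<le> a * x + (1 - a) * y" if "p \<le> x" "p \<le> y" for p x y :: real
    using that assms(3) mult_left_mono[of p x a] mult_left_mono[of p y "1 - a"]
    by (simp add: algebra_simps)
  moreover have "a * x + (1 - a) * y \<le> p" if "x \<le> p" "y \<le> p" for p x y :: real
    using that assms(3) mult_left_mono[of x p a] mult_left_mono[of y p "1 - a"]
    by (simp add: algebra_simps)
  ultimately show ?thesis
    using assms(1,2) unfolding entropy_stable_interface_def comb by blast
qed

section \<open>Traces of self-similar entropy inequalities\<close>

text \<open>A zero of a nonnegative function is a minimum. Hence the derivative of a nonnegative test function
  vanishes wherever the function does, including at the end points of its support.\<close>

lemma nonneg_zero_imp_DERIV_zero:
  fixes g :: "real \<Rightarrow> real"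
  assumes "(g has_real_derivative d) (at x)" and "\<And>y. 0 \<le> g y" and "g x = 0"
  shows "d = 0"
  using DERIV_local_min[OF assms(1) zero_less_one] assms(2,3) by auto

lemma integrable_bounded_support:
  fixes g :: "real \<Rightarrow> real"
  assumes "g \<in> borel_measurable borel" and "\<And>x. \<bar>g x\<bar> \<le> K" and "\<And>x. x \<notin> {l..r} \<Longrightarrow> g x = 0"
  shows "integrable lborel g"
  by (rule integrableI_bounded_set[of "{l..r}" _ _ K]) (use assms in \<open>auto simp: emeasure_lborel_Icc_eq\<close>)

lemma continuous_compact_support_bounded:
  fixes g :: "real \<Rightarrow> real"
  assumes "continuous_on {l..r} g" and "\<And>x. x \<notin> {l..r} \<Longrightarrow> g x = 0"
  obtains K where "0 \<le> K" "\<And>x. \<bar>g x\<bar> \<le> K"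
proof -
  obtain K where K: "\<And>x. x \<in> {l..r} \<Longrightarrow> norm (g x) \<le> K"
    using compact_imp_bounded[OF compact_continuous_image[OF assms(1) compact_Icc]]
    unfolding bounded_iff by blast
  have "\<bar>g x\<bar> \<le> max K 0" for x
    using K[of x] assms(2)[of x] by (cases "x \<in> {l..r}") auto
  then show ?thesis by (intro that[of "max K 0"]) auto
qed

lemma integral_derivative_compact_support:
  fixes G g :: "real \<Rightarrow> real"
  assumes "\<And>x. (G has_real_derivative g x) (at x)" and "continuous_on UNIV g"
    and "\<And>x. x \<notin> {l..r} \<Longrightarrow> g x = 0" and "l \<le> r"
  shows "(\<integral>x. g x \<partial>lborel) = G r - G l"
proof -
  have "(\<integral>x. g x \<partial>lborel) = (\<integral>x. g x * indicator {l..r} x \<partial>lborel)"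
    by (rule Bochner_Integration.integral_cong) (use assms(3) in \<open>auto simp: indicator_def\<close>)
  also have "\<dots> = G r - G l"
    by (rule integral_FTC_Icc_real)
      (use assms in \<open>auto simp: continuous_on_eq_continuous_at\<close>)
  finally show ?thesis .
qed

text \<open>The entropy inequality \<open>\<partial>\<^sub>t a(x/t) + \<partial>\<^sub>x b(x/t) \<le> 0\<close> tested with products
  \<open>\<rho>(x) \<theta>(t)\<close>, as an iterated integral. Support of \<open>\<theta>\<close> in the interval from 1 to 2 keeps
  away from \<open>t = 0\<close> and bounds the factor between \<open>x\<close> and \<open>\<xi> = x/t\<close>.\<close>

definition tensor_ineq :: "(real \<Rightarrow> real) \<Rightarrow> (real \<Rightarrow> real) \<Rightarrow> bool" where
  "tensor_ineq a b \<longleftrightarrow> (\<forall>\<rho> \<rho>' \<theta> \<theta>' R.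
     smooth \<rho> \<and> (\<forall>x. 0 \<le> \<rho> x) \<and> (\<forall>x. (\<rho> has_real_derivative \<rho>' x) (at x)) \<and>
     (\<forall>x. x \<notin> {-R..R} \<longrightarrow> \<rho> x = 0) \<and>
     smooth \<theta> \<and> (\<forall>t. 0 \<le> \<theta> t) \<and> (\<forall>t. (\<theta> has_real_derivative \<theta>' t) (at t)) \<and>
     (\<forall>t. t \<notin> {1..2} \<longrightarrow> \<theta> t = 0) \<longrightarrow>
     0 \<le> (\<integral>t. (\<integral>x. \<theta>' t * \<rho> x * a (x / t) + \<theta> t * \<rho>' x * b (x / t) \<partial>lborel) \<partial>lborel))"

text \<open>Integrating \<open>(b - \<xi> a)' + a \<le> 0\<close> over \<open>\<xi> > 0\<close> gives \<open>b0 \<ge> C\<close> with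
  \<open>C = \<integral>\<^bsub>\<xi>>0\<^esub> a \<ge> 0\<close>. To obtain this from the tested inequality, \<open>\<rho> n\<close> rises from 0 to 1 in an interval
  of length \<open>1/(n+1)\<close> adjacent to \<open>0\<close> and falls back to 0 beyond the point \<open>c\<close>, where \<open>a\<close> and \<open>b\<close> vanish.
  In the limit the term with \<open>\<theta>'\<close> becomes \<open>\<integral> \<theta>'(t) t C dt = -C\<close>, while \<open>\<rho>'\<close> acts as a
  one-sided delta function at \<open>0\<close>, so that the other term becomes \<open>b0\<close>.\<close>

lemma tensor_ineq_trace_nonneg:
  fixes a b :: "real \<Rightarrow> real"
  assumes [measurable]: "a \<in> borel_measurable borel" "b \<in> borel_measurable borel"
    and aK: "\<And>\<xi>. \<bar>a \<xi>\<bar> \<le> K" and bK: "\<And>\<xi>. \<bar>b \<xi>\<bar> \<le> K"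
    and a0: "\<And>\<xi>. 0 \<le> a \<xi>" and far: "\<And>\<xi>. M \<le> \<xi> \<Longrightarrow> a \<xi> = 0 \<and> b \<xi> = 0"
    and lim: "(b \<longlongrightarrow> b0) (at_left 0) \<or> (b \<longlongrightarrow> b0) (at_right 0)"
    and ineq: "tensor_ineq a b"
  shows "0 \<le> b0"
proof -
  have K0: "0 \<le> K" using aK[of 0] by linarith
  obtain \<beta> B :: "real \<Rightarrow> real" where bump: "smooth \<beta> \<and> (\<forall>x. 0 \<le> \<beta> x) \<and>
      (\<forall>x. x \<notin> {0<..<1} \<longrightarrow> \<beta> x = 0) \<and> (\<forall>x. (B has_real_derivative \<beta> x) (at x)) \<and>
      (\<forall>x\<le>0. B x = 0) \<and> (\<forall>x\<ge>1. B x = 1)"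
    using bump_exists by (elim exE)
  then have \<beta>: "smooth \<beta>" "\<And>x. 0 \<le> \<beta> x" "\<And>x. x \<notin> {0<..<1} \<Longrightarrow> \<beta> x = 0"
    and B: "\<And>x. (B has_real_derivative \<beta> x) (at x)" "\<And>x. x \<le> 0 \<Longrightarrow> B x = 0" "\<And>x. x \<ge> 1 \<Longrightarrow> B x = 1"
    by blast+
  define \<beta>' where "\<beta>' x = frechet_derivative \<beta> (at x) 1" for x
  have d\<beta>: "(\<beta> has_real_derivative \<beta>' x) (at x)" for x
    unfolding \<beta>'_def by (rule smooth_DERIV[OF \<beta>(1)])
  have c\<beta>: "continuous_on UNIV \<beta>" "continuous_on UNIV \<beta>'"
    using smooth_continuous[OF \<beta>(1)] smooth_DERIV_continuous[OF \<beta>(1) d\<beta>] by auto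
  have [measurable]: "\<beta> \<in> borel_measurable borel" "\<beta>' \<in> borel_measurable borel"
    using c\<beta> by (auto intro: borel_measurable_continuous_onI)
  have \<beta>'0: "\<beta>' x = 0" if "x \<notin> {0<..<1}" for x
    using nonneg_zero_imp_DERIV_zero[OF d\<beta> \<beta>(2) \<beta>(3)[OF that]] .
  have smB: "smooth B" by (rule smooth_antiderivative[OF B(1) \<beta>(1)])
  have [measurable]: "B \<in> borel_measurable borel"
    using smooth_continuous[OF smB] by (rule borel_measurable_continuous_onI)
  have Bmono: "B x \<le> B y" if "x \<le> y" for x y
    using that by (intro DERIV_nonneg_imp_nondecreasing[of x y B]) (auto intro!: exI[of _ "\<beta> _"] B \<beta>)
  have B01: "0 \<le> B x" "B x \<le> 1" for x
    using Bmono[of "min x 0" x] B(2)[of "min x 0"] Bmono[of x "max x 1"] B(3)[of "max x 1"] by auto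
  obtain L where L: "0 \<le> L" "\<And>x. \<bar>\<beta> x\<bar> \<le> L"
    by (rule continuous_compact_support_bounded[of 0 1 \<beta>])
      (use c\<beta> \<beta>(3) in \<open>auto intro: continuous_on_subset\<close>)
  obtain L' where L': "0 \<le> L'" "\<And>x. \<bar>\<beta>' x\<bar> \<le> L'"
    by (rule continuous_compact_support_bounded[of 0 1 \<beta>'])
      (use c\<beta> \<beta>'0 in \<open>auto intro: continuous_on_subset\<close>)
  have int\<beta>: "integrable lborel \<beta>"
    by (rule integrable_bounded_support[of _ L 0 1]) (use L \<beta>(3) in auto)
  have I\<beta>: "(\<integral>x. \<beta> x \<partial>lborel) = 1"
  proof -
    have "(\<integral>x. \<beta> x \<partial>lborel) = B 1 - B 0"
      by (rule integral_derivative_compact_support[OF B(1) c\<beta>(1)]) (use \<beta>(3) in auto)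
    then show ?thesis using B(2)[of 0] B(3)[of 1] by simp
  qed
  \<comment> \<open>The rise takes place where \<open>0 < (n+1) x + s < 1\<close>: to the right of \<open>0\<close> for \<open>s = 0\<close>, to the left for
    \<open>s = 1\<close>, according to the side from which \<open>b\<close> tends to \<open>b0\<close>.\<close>
  define s :: real where "s = (if (b \<longlongrightarrow> b0) (at_right 0) then 0 else 1)"
  have s: "0 \<le> s" "s \<le> 1" by (auto simp: s_def)
  \<comment> \<open>As \<open>t < 2\<close> on the support of \<open>\<theta>\<close>, \<open>x \<ge> c\<close> implies \<open>x / t \<ge> M\<close>.\<close>
  define c where "c = 2 * max M 0"
  have c: "0 \<le> c" by (simp add: c_def)
  have far': "a (x / t) = 0" "b (x / t) = 0" if "c \<le> x" "t \<in> {1<..<2}" for x t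
  proof -
    have "M * t \<le> max M 0 * t" "max M 0 * t \<le> max M 0 * 2"
      using that by (auto intro!: mult_right_mono mult_left_mono)
    then have "M * t \<le> x" using that(1) unfolding c_def by linarith
    then have "M \<le> x / t" using that(2) by (simp add: pos_le_divide_eq)
    then show "a (x / t) = 0" "b (x / t) = 0" using far by auto
  qed
  define \<rho> where "\<rho> n x = B (real (Suc n) * x + s) - B (x + - c)" for n x
  define \<rho>' where "\<rho>' n x = real (Suc n) * \<beta> (real (Suc n) * x + s) - \<beta> (x + - c)" for n x
  define \<theta> where "\<theta> t = \<beta> (t + - 1)" for t
  define \<theta>' where "\<theta>' t = \<beta>' (t + - 1)" for t
  have [measurable]: "\<rho> n \<in> borel_measurable borel" "\<rho>' n \<in> borel_measurable borel"
    "\<theta> \<in> borel_measurable borel" "\<theta>' \<in> borel_measurable borel" for n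
    unfolding \<rho>_def[abs_def] \<rho>'_def[abs_def] \<theta>_def[abs_def] \<theta>'_def[abs_def] by measurable
  have sm: "smooth (\<rho> n)" for n
  proof -
    have "smooth (\<lambda>x. B (real (Suc n) * x + s))"
      by (rule smooth_affine[OF _ smB]) (rule bounded_linear_mult_right)
    moreover have "smooth (\<lambda>x. (- 1) * B (x + - c))"
      by (intro smooth_mult smooth_const smooth_affine[OF bounded_linear_ident smB])
    ultimately have "smooth (\<lambda>x. B (real (Suc n) * x + s) + (- 1) * B (x + - c))"
      by (rule smooth_add)
    then show ?thesis by (simp add: \<rho>_def[abs_def])
  qed
  have sm\<theta>: "smooth \<theta>"
    unfolding \<theta>_def[abs_def] by (rule smooth_affine[OF bounded_linear_ident \<beta>(1)])
  have d\<rho>: "(\<rho> n has_real_derivative \<rho>' n x) (at x)" for n x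
    unfolding \<rho>_def[abs_def] \<rho>'_def
    by (auto intro!: derivative_eq_intros DERIV_chain2[OF B(1)])
  have d\<theta>: "(\<theta> has_real_derivative \<theta>' t) (at t)" for t
    unfolding \<theta>_def[abs_def] \<theta>'_def
    by (rule d\<beta>[of "t + - 1", unfolded DERIV_shift])
  have \<theta>0: "\<theta> t = 0" "\<theta>' t = 0" if "t \<notin> {1<..<2}" for t
    using that \<beta>(3) \<beta>'0 by (auto simp: \<theta>_def \<theta>'_def)
  have Nx: "x \<le> real (Suc n) * x" if "0 \<le> x" for n x
    using that by (simp add: algebra_simps)
  have Nx': "real (Suc n) * x \<le> x" if "x \<le> 0" for n x
    using that by (simp add: algebra_simps mult_nonpos_nonneg)
  have \<rho>0: "0 \<le> \<rho> n x" for n x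
  proof (cases "0 \<le> x")
    case True
    have "x + - c \<le> real (Suc n) * x + s" using Nx[OF True, of n] s c by linarith
    then show ?thesis using Bmono unfolding \<rho>_def by (simp del: of_nat_Suc)
  next
    case False
    then show ?thesis using B01 B(2)[of "x + - c"] c unfolding \<rho>_def by simp
  qed
  have \<rho>1: "\<rho> n x \<le> 1" for n x
    using B01[of "real (Suc n) * x + s"] B01[of "x + - c"] unfolding \<rho>_def by linarith
  have \<rho>supp: "\<rho> n x = 0" if "x \<notin> {-1..c+1}" for n x
  proof -
    consider "x < -1" | "x > c + 1" using \<open>x \<notin> _\<close> by fastforce
    then show ?thesis
    proof cases
      case 1
      then have "real (Suc n) * x + s \<le> 0" using Nx'[of x n] s by linarith
      then show ?thesis using B(2) 1 c unfolding \<rho>_def by (simp del: of_nat_Suc)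
    next
      case 2
      then have "1 \<le> real (Suc n) * x + s" using Nx[of x n] s c by linarith
      then show ?thesis using B(3) 2 unfolding \<rho>_def by (simp del: of_nat_Suc)
    qed
  qed
  have \<rho>'supp: "\<rho>' n x = 0" if "x \<notin> {-1..c+1}" for n x
    using nonneg_zero_imp_DERIV_zero[OF d\<rho> \<rho>0 \<rho>supp[OF that]] .
  have \<rho>'b: "\<bar>\<rho>' n x\<bar> \<le> real (Suc n) * L + L" for n x
  proof -
    have "\<bar>\<rho>' n x\<bar> \<le> real (Suc n) * \<bar>\<beta> (real (Suc n) * x + s)\<bar> + \<bar>\<beta> (x + - c)\<bar>"
      unfolding \<rho>'_def by (rule order_trans[OF abs_triangle_ineq4]) (simp add: abs_mult)
    also have "\<dots> \<le> real (Suc n) * L + L"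
      by (intro add_mono mult_left_mono L) auto
    finally show ?thesis .
  qed
  have \<rho>a: "\<bar>\<rho> n x * a y\<bar> \<le> K * indicator {-1..c+1} x" for n x y
  proof (cases "x \<in> {-1..c+1}")
    case True
    have "\<rho> n x * \<bar>a y\<bar> \<le> 1 * K" by (intro mult_mono \<rho>1 aK) auto
    then show ?thesis using True \<rho>0 by (simp add: abs_mult)
  qed (use \<rho>supp in auto)
  have intK: "integrable lborel (\<lambda>x. K * indicator {-1..c+1} x)"
    by (rule integrable_bounded_support[of _ K "-1" "c+1"]) (auto simp: indicator_def K0)
  have large: "\<forall>\<^sub>F n in sequentially. 1 \<le> real (Suc n) * z" if z: "0 < z" for z
  proof -
    obtain N :: nat where N: "1 < real N * z" using reals_Archimedean3[OF z] by blast
    have "1 \<le> real (Suc n) * z" if "N \<le> n" for n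
      using N mult_right_mono[of "real N" "real (Suc n)" z] that z by linarith
    then show ?thesis by (rule eventually_sequentiallyI)
  qed
  define J where "J n t = (\<integral>x. \<rho> n x * a (x / t) \<partial>lborel)" for n t
  define Q where "Q n t = (\<integral>x. \<rho>' n x * b (x / t) \<partial>lborel)" for n t
  have [measurable]: "J n \<in> borel_measurable borel" "Q n \<in> borel_measurable borel" for n
    unfolding J_def[abs_def] Q_def[abs_def] by measurable
  have iJ: "integrable lborel (\<lambda>x. \<rho> n x * a (x / t))" for n t
    by (rule Bochner_Integration.integrable_bound[OF intK]) (use \<rho>a K0 in auto)
  have iQ: "integrable lborel (\<lambda>x. \<rho>' n x * b (x / t))" for n t
  proof (rule integrable_bounded_support[of _ "(real (Suc n) * L + L) * K" "-1" "c+1"])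
    show "\<bar>\<rho>' n x * b (x / t)\<bar> \<le> (real (Suc n) * L + L) * K" for x
      unfolding abs_mult using L(1) by (intro mult_mono \<rho>'b bK) auto
  qed (use \<rho>'supp in auto)
  have main: "0 \<le> (\<integral>t. \<theta>' t * J n t + \<theta> t * Q n t \<partial>lborel)" for n
  proof -
    have "0 \<le> (\<integral>t. (\<integral>x. \<theta>' t * \<rho> n x * a (x / t) + \<theta> t * \<rho>' n x * b (x / t) \<partial>lborel) \<partial>lborel)"
    proof (rule ineq[unfolded tensor_ineq_def, rule_format, where R = "c+1"], intro conjI allI impI)
      show "\<rho> n x = 0" if "x \<notin> {-(c+1)..c+1}" for x
        using \<rho>supp[of x n] that c by auto
      show "\<theta> t = 0" if "t \<notin> {1..2}" for t
        using \<theta>0(1)[of t] that by auto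
      show "0 \<le> \<theta> t" for t by (simp add: \<theta>_def \<beta>(2))
    qed (fact sm sm\<theta> \<rho>0 d\<rho> d\<theta>)+
    also have "\<dots> = (\<integral>t. \<theta>' t * J n t + \<theta> t * Q n t \<partial>lborel)"
      by (simp add: J_def Q_def mult.assoc Bochner_Integration.integral_add iJ iQ)
    finally show ?thesis .
  qed
  define C where "C = (\<integral>\<xi>. indicator {0<..} \<xi> * a \<xi> \<partial>lborel)"
  have C0: "0 \<le> C" unfolding C_def by (intro Bochner_Integration.integral_nonneg) (simp add: a0)
  \<comment> \<open>Self-similarity enters here: the substitution \<open>x = t \<xi>\<close> produces the factor \<open>t\<close>.\<close>
  have Jlim: "(\<lambda>n. J n t) \<longlonglongrightarrow> t * C" if t: "t \<in> {1<..<2}" for t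
  proof -
    have "(\<lambda>n. J n t) \<longlonglongrightarrow> (\<integral>x. indicator {0<..} x * a (x / t) \<partial>lborel)"
      unfolding J_def
    proof (rule integral_dominated_convergence[OF _ _ intK])
      show "AE x in lborel. (\<lambda>n. \<rho> n x * a (x / t)) \<longlonglongrightarrow> indicator {0<..} x * a (x / t)"
        using AE_lborel_singleton[of "0::real"]
      proof eventually_elim
        fix x :: real assume "x \<noteq> 0"
        then consider "x < 0" | "0 < x" "x \<le> c" | "0 < x" "c \<le> x" by linarith
        then show "(\<lambda>n. \<rho> n x * a (x / t)) \<longlonglongrightarrow> indicator {0<..} x * a (x / t)"
        proof cases
          case 1
          have "\<forall>\<^sub>F n in sequentially. real (Suc n) * x + s \<le> 0"
            using large[of "- x"] 1 s by (auto elim!: eventually_mono)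
          then have "\<forall>\<^sub>F n in sequentially. \<rho> n x * a (x / t) = indicator {0<..} x * a (x / t)"
            by (rule eventually_mono) (use 1 c B(2) in \<open>simp add: \<rho>_def del: of_nat_Suc\<close>)
          then show ?thesis by (rule tendsto_eventually)
        next
          case 2
          have "\<forall>\<^sub>F n in sequentially. 1 \<le> real (Suc n) * x + s"
            using large[of x] 2 s by (auto elim!: eventually_mono)
          then have "\<forall>\<^sub>F n in sequentially. \<rho> n x * a (x / t) = indicator {0<..} x * a (x / t)"
            by (rule eventually_mono) (use 2 B(2,3) in \<open>simp add: \<rho>_def del: of_nat_Suc\<close>)
          then show ?thesis by (rule tendsto_eventually)
        next
          case 3
          then show ?thesis using far'[OF _ t] by simp
        qed
      qed
    qed (use \<rho>a in auto)
    also have "(\<integral>x. indicator {0<..} x * a (x / t) \<partial>lborel)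
        = t * (\<integral>\<xi>. indicator {0<..} (0 + t * \<xi>) * a ((0 + t * \<xi>) / t) \<partial>lborel)"
      using t by (subst lborel_integral_real_affine[of t _ 0]) auto
    also have "(\<integral>\<xi>. indicator {0<..} (0 + t * \<xi>) * a ((0 + t * \<xi>) / t) \<partial>lborel) = C"
      unfolding C_def using t
      by (intro Bochner_Integration.integral_cong) (auto simp: indicator_def zero_less_mult_iff)
    finally show ?thesis .
  qed
  \<comment> \<open>The substitution \<open>y = (n+1) x + s\<close> resolves the delta function; the falling part of \<open>\<rho> n\<close>
    contributes nothing.\<close>
  have Qeq: "Q n t = (\<integral>y. \<beta> y * b ((y - s) / (real (Suc n) * t)) \<partial>lborel)"
    if t: "t \<in> {1<..<2}" for n t
  proof -
    have "\<beta> (x + - c) * b (x / t) = 0" for x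
      using far'(2)[OF _ t, of x] \<beta>(3)[of "x + - c"] by (cases "c \<le> x") auto
    then have "Q n t = (\<integral>x. real (Suc n) * (\<beta> (s + real (Suc n) * x) *
        b ((s + real (Suc n) * x - s) / (real (Suc n) * t))) \<partial>lborel)"
      unfolding Q_def \<rho>'_def
      by (intro Bochner_Integration.integral_cong) (auto simp: left_diff_distrib add.commute simp del: of_nat_Suc)
    also have "\<dots> = (\<integral>y. \<beta> y * b ((y - s) / (real (Suc n) * t)) \<partial>lborel)"
      by (subst lborel_integral_real_affine[of "real (Suc n)" _ s]) (simp_all del: of_nat_Suc)
    finally show ?thesis .
  qed
  have intK\<beta>: "integrable lborel (\<lambda>y. K * \<beta> y)" using int\<beta> by simp
  have \<beta>b: "\<bar>\<beta> y * b z\<bar> \<le> K * \<beta> y" for y z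
    using mult_right_mono[OF bK[of z] \<beta>(2)[of y]] \<beta>(2)[of y] by (simp add: abs_mult mult.commute)
  have blim: "(\<lambda>n. b ((y - s) / (real (Suc n) * t))) \<longlonglongrightarrow> b0"
    if y: "y \<in> {0<..<1}" and t: "t \<in> {1<..<2}" for y t
  proof -
    have lim0: "(\<lambda>n. (y - s) / (real (Suc n) * t)) \<longlonglongrightarrow> 0"
      using tendsto_mult_right_zero[OF LIMSEQ_inverse_real_of_nat, of "(y - s) / t"]
      by (simp add: field_simps)
    show ?thesis
    proof (cases "(b \<longlongrightarrow> b0) (at_right 0)")
      case True
      have "filterlim (\<lambda>n. (y - s) / (real (Suc n) * t)) (at_right 0) sequentially"
        using lim0 y t True by (intro tendsto_imp_filterlim_at_right) (auto simp: s_def)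
      with True show ?thesis by (rule filterlim_compose)
    next
      case False
      have "filterlim (\<lambda>n. (y - s) / (real (Suc n) * t)) (at_left 0) sequentially"
        using lim0 y t False
        by (intro tendsto_imp_filterlim_at_left) (auto simp: s_def divide_less_0_iff)
      moreover have "(b \<longlongrightarrow> b0) (at_left 0)" using False lim by auto
      ultimately show ?thesis by (rule filterlim_compose[rotated])
    qed
  qed
  have Qlim: "(\<lambda>n. Q n t) \<longlonglongrightarrow> b0" if t: "t \<in> {1<..<2}" for t
  proof -
    have "(\<lambda>n. Q n t) \<longlonglongrightarrow> (\<integral>y. \<beta> y * b0 \<partial>lborel)"
      unfolding Qeq[OF t]
    proof (rule integral_dominated_convergence[OF _ _ intK\<beta>])
      show "AE y in lborel. (\<lambda>n. \<beta> y * b ((y - s) / (real (Suc n) * t))) \<longlonglongrightarrow> \<beta> y * b0"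
      proof (intro AE_I2)
        show "(\<lambda>n. \<beta> y * b ((y - s) / (real (Suc n) * t))) \<longlonglongrightarrow> \<beta> y * b0" for y
          using blim[OF _ t, of y] \<beta>(3)[of y]
          by (cases "y \<in> {0<..<1}") (auto intro!: tendsto_mult_left)
      qed
    qed (use \<beta>b in auto)
    then show ?thesis using I\<beta> by simp
  qed
  have Jb: "\<bar>J n t\<bar> \<le> K * (c + 2)" for n t
  proof -
    have "\<bar>J n t\<bar> \<le> (\<integral>x. K * indicator {-1..c+1} x \<partial>lborel)"
      unfolding J_def using \<rho>a
      by (intro order_trans[OF integral_abs_bound] integral_mono integrable_abs iJ intK) auto
    also have "\<dots> = K * (c + 2)" using c by simp
    finally show ?thesis .
  qed
  have Qb: "\<bar>Q n t\<bar> \<le> K" if t: "t \<in> {1<..<2}" for n t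
  proof -
    have "\<bar>Q n t\<bar> \<le> (\<integral>y. K * \<beta> y \<partial>lborel)"
      unfolding Qeq[OF t] using \<beta>b
      by (intro order_trans[OF integral_abs_bound] integral_mono integrable_abs intK\<beta>
          Bochner_Integration.integrable_bound[OF intK\<beta>]) (auto simp: abs_of_nonneg K0 \<beta>(2))
    then show ?thesis using I\<beta> by simp
  qed
  have "(\<lambda>n. \<integral>t. \<theta>' t * J n t + \<theta> t * Q n t \<partial>lborel) \<longlonglongrightarrow>
      (\<integral>t. \<theta>' t * (t * C) + \<theta> t * b0 \<partial>lborel)"
  proof (rule integral_dominated_convergence)
    show "integrable lborel (\<lambda>t. \<bar>\<theta>' t\<bar> * (K * (c + 2)) + \<theta> t * K)"
    proof (intro Bochner_Integration.integrable_add integrable_mult_left integrable_abs)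
      show "integrable lborel \<theta>'"
        by (rule integrable_bounded_support[of _ L' 1 2]) (use \<theta>0 L' in \<open>auto simp: \<theta>'_def\<close>)
      show "integrable lborel \<theta>"
        by (rule integrable_bounded_support[of _ L 1 2]) (use \<theta>0 L in \<open>auto simp: \<theta>_def\<close>)
    qed
    show "AE t in lborel. (\<lambda>n. \<theta>' t * J n t + \<theta> t * Q n t) \<longlonglongrightarrow> \<theta>' t * (t * C) + \<theta> t * b0"
    proof (intro AE_I2)
      show "(\<lambda>n. \<theta>' t * J n t + \<theta> t * Q n t) \<longlonglongrightarrow> \<theta>' t * (t * C) + \<theta> t * b0" for t
        using Jlim[of t] Qlim[of t] \<theta>0[of t]
        by (cases "t \<in> {1<..<2}") (auto intro!: tendsto_intros)
    qed
    show "AE t in lborel. norm (\<theta>' t * J n t + \<theta> t * Q n t) \<le> \<bar>\<theta>' t\<bar> * (K * (c + 2)) + \<theta> t * K" for n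
    proof (intro AE_I2)
      fix t
      have \<theta>: "\<theta> t \<ge> 0" by (simp add: \<theta>_def \<beta>)
      show "norm (\<theta>' t * J n t + \<theta> t * Q n t) \<le> \<bar>\<theta>' t\<bar> * (K * (c + 2)) + \<theta> t * K"
      proof (cases "t \<in> {1<..<2}")
        case True
        have "norm (\<theta>' t * J n t + \<theta> t * Q n t) \<le> \<bar>\<theta>' t\<bar> * \<bar>J n t\<bar> + \<theta> t * \<bar>Q n t\<bar>"
          using abs_triangle_ineq[of "\<theta>' t * J n t" "\<theta> t * Q n t"] \<theta> by (simp add: abs_mult)
        also have "\<dots> \<le> \<bar>\<theta>' t\<bar> * (K * (c + 2)) + \<theta> t * K"
          using \<theta> by (intro add_mono mult_left_mono Jb Qb True) auto
        finally show ?thesis .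
      qed (use \<theta>0 in auto)
    qed
  qed auto
  then have "0 \<le> (\<integral>t. \<theta>' t * (t * C) + \<theta> t * b0 \<partial>lborel)"
    using main by (intro LIMSEQ_le_const) auto
  \<comment> \<open>\<open>\<theta>'(t) t C + \<theta>(t) b0\<close> is the derivative of \<open>t \<theta>(t) C + B(t-1) (b0 - C)\<close>.\<close>
  also have "(\<integral>t. \<theta>' t * (t * C) + \<theta> t * b0 \<partial>lborel)
      = (2 * \<theta> 2 * C + B (2 + - 1) * (b0 - C)) - (1 * \<theta> 1 * C + B (1 + - 1) * (b0 - C))"
  proof (rule integral_derivative_compact_support
      [where G = "\<lambda>t. t * \<theta> t * C + B (t + - 1) * (b0 - C)"])
    show "((\<lambda>t. t * \<theta> t * C + B (t + - 1) * (b0 - C)) has_real_derivative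
        \<theta>' t * (t * C) + \<theta> t * b0) (at t)" for t
      by (auto intro!: derivative_eq_intros d\<theta> DERIV_chain2[OF B(1)] simp: \<theta>_def[of t] algebra_simps)
    show "continuous_on UNIV (\<lambda>t. \<theta>' t * (t * C) + \<theta> t * b0)"
      using smooth_continuous[OF sm\<theta>] smooth_DERIV_continuous[OF sm\<theta> d\<theta>]
      by (intro continuous_intros)
    show "\<theta>' t * (t * C) + \<theta> t * b0 = 0" if "t \<notin> {1..2}" for t
      using \<theta>0[of t] that by auto
  qed simp
  also have "\<dots> = b0 - C"
    using B(2)[of 0] B(3)[of 1] \<theta>0(1)[of 1] \<theta>0(1)[of 2] by simp
  finally show ?thesis using C0 by simp
qed

text \<open>The reflection \<open>x \<mapsto> -x\<close> reverses the sign of the flux. It reduces the left state of a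
  Riemann problem to the right one.\<close>

lemma tensor_ineq_reflect:
  assumes "tensor_ineq a b"
  shows "tensor_ineq (\<lambda>\<xi>. a (- \<xi>)) (\<lambda>\<xi>. - b (- \<xi>))"
  unfolding tensor_ineq_def
proof (intro allI impI, elim conjE)
  fix \<rho> \<rho>' \<theta> \<theta>' :: "real \<Rightarrow> real" and R
  assume \<rho>: "smooth \<rho>" "\<forall>x. 0 \<le> \<rho> x" "\<forall>x. (\<rho> has_real_derivative \<rho>' x) (at x)"
    "\<forall>x. x \<notin> {-R..R} \<longrightarrow> \<rho> x = 0"
    and \<theta>: "smooth \<theta>" "\<forall>t. 0 \<le> \<theta> t" "\<forall>t. (\<theta> has_real_derivative \<theta>' t) (at t)"
    "\<forall>t. t \<notin> {1..2} \<longrightarrow> \<theta> t = 0"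
  have "0 \<le> (\<integral>t. (\<integral>x. \<theta>' t * \<rho> (- x) * a (x / t) + \<theta> t * (- \<rho>' (- x)) * b (x / t) \<partial>lborel) \<partial>lborel)"
  proof (rule assms[unfolded tensor_ineq_def, rule_format, where R = R], intro conjI allI impI)
    show "smooth (\<lambda>x. \<rho> (- x))"
      using smooth_affine[OF bounded_linear_minus[OF bounded_linear_ident] \<rho>(1), of 0] by simp
    show "((\<lambda>x. \<rho> (- x)) has_real_derivative - \<rho>' (- x)) (at x)" for x
      using DERIV_chain2[OF \<rho>(3)[rule_format] DERIV_minus[OF DERIV_ident], of x] by simp
  qed (use \<rho> \<theta> in auto)
  also have "(\<lambda>t. \<integral>x. \<theta>' t * \<rho> (- x) * a (x / t) + \<theta> t * (- \<rho>' (- x)) * b (x / t) \<partial>lborel)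
      = (\<lambda>t. \<integral>x. \<theta>' t * \<rho> x * a (- (x / t)) + \<theta> t * \<rho>' x * - b (- (x / t)) \<partial>lborel)"
    by (subst lborel_integral_real_affine[of "-1" _ 0]) auto
  finally show "0 \<le> (\<integral>t. (\<integral>x. \<theta>' t * \<rho> x * a (- (x / t)) + \<theta> t * \<rho>' x * - b (- (x / t)) \<partial>lborel) \<partial>lborel)" .
qed

section \<open>Riemann solutions and Godunov's flux\<close>

lemma tensor_has_derivative:
  fixes \<rho> \<theta> :: "real \<Rightarrow> real"
  assumes "\<And>x. (\<rho> has_real_derivative \<rho>' x) (at x)" and "\<And>t. (\<theta> has_real_derivative \<theta>' t) (at t)"
  shows "frechet_derivative (\<lambda>p. \<rho> (fst p) * \<theta> (snd p)) (at z)
    = (\<lambda>h. \<rho> (fst z) * (\<theta>' (snd z) * snd h) + \<rho>' (fst z) * fst h * \<theta> (snd z))"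
proof -
  have "((\<lambda>p. \<rho> (fst p)) has_derivative (\<lambda>h. \<rho>' (fst z) * fst h)) (at z)"
    using has_derivative_compose[OF has_derivative_fst[OF has_derivative_ident]
        assms(1)[of "fst z", unfolded has_field_derivative_def]] .
  moreover have "((\<lambda>p. \<theta> (snd p)) has_derivative (\<lambda>h. \<theta>' (snd z) * snd h)) (at z)"
    using has_derivative_compose[OF has_derivative_snd[OF has_derivative_ident]
        assms(2)[of "snd z", unfolded has_field_derivative_def]] .
  ultimately show ?thesis
    by (rule frechet_derivative_at[OF has_derivative_mult, symmetric])
qed

text \<open>The support in time bounds the support of the product away from the line \<open>t = 0\<close>.\<close>

lemma tensor_test_function:
  fixes \<rho> \<theta> :: "real \<Rightarrow> real"
  assumes "smooth \<rho>" "smooth \<theta>"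
    and "\<And>x. x \<notin> {-R..R} \<Longrightarrow> \<rho> x = 0" "\<And>t. t \<notin> {1..2} \<Longrightarrow> \<theta> t = 0"
  shows "test_function (\<lambda>p. \<rho> (fst p) * \<theta> (snd p))"
proof -
  let ?S = "closure {p. \<rho> (fst p) * \<theta> (snd p) \<noteq> 0}"
  have K: "compact ({-R..R} \<times> {1..2::real})" by (intro compact_Times compact_Icc)
  have supp: "{p. \<rho> (fst p) * \<theta> (snd p) \<noteq> 0} \<subseteq> {-R..R} \<times> {1..2}"
    using assms(3,4) unfolding mem_Times_iff subset_iff by (metis (mono_tags) mem_Collect_eq mult_eq_0_iff)
  then have sub: "?S \<subseteq> {-R..R} \<times> {1..2}"
    using K by (intro closure_minimal compact_imp_closed)
  then have "compact ?S"
    using bounded_subset[OF compact_imp_bounded[OF K] supp] by (simp add: compact_closure)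
  moreover have "?S \<subseteq> half_plane" using sub by force
  moreover have "smooth (\<lambda>p. \<rho> (fst p) * \<theta> (snd p))"
    using smooth_mult[OF smooth_affine[OF bounded_linear_fst assms(1), of 0]
        smooth_affine[OF bounded_linear_snd assms(2), of 0]] by simp
  ultimately show ?thesis by (simp add: test_function_def)
qed

lemma integrable_tensor:
  fixes h :: "real \<Rightarrow> 'a::euclidean_space" and p q :: "real \<Rightarrow> real"
  assumes cont: "continuous_on UNIV p" "continuous_on UNIV q"
    and p0: "\<And>x. x \<notin> {-R..R} \<Longrightarrow> p x = 0" and q0: "\<And>t. t \<notin> {1..2} \<Longrightarrow> q t = 0"
    and [measurable]: "h \<in> borel_measurable borel" and h: "bounded (range h)"
  shows "integrable lborel (\<lambda>z. (p (fst z) * q (snd z)) *\<^sub>R h (fst z / snd z))"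
proof -
  obtain P where P: "0 \<le> P" "\<And>x. \<bar>p x\<bar> \<le> P"
    by (rule continuous_compact_support_bounded[of "-R" R p])
      (use cont p0 in \<open>auto intro: continuous_on_subset\<close>)
  obtain Q where Q: "0 \<le> Q" "\<And>x. \<bar>q x\<bar> \<le> Q"
    by (rule continuous_compact_support_bounded[of 1 2 q])
      (use cont q0 in \<open>auto intro: continuous_on_subset\<close>)
  obtain H where H: "\<And>x. norm (h x) \<le> H" using h by (auto simp: bounded_iff)
  have [measurable]: "p \<in> borel_measurable borel" "q \<in> borel_measurable borel"
    using cont by (auto intro: borel_measurable_continuous_onI)
  have K: "compact ({-R..R} \<times> {1..2::real})" by (intro compact_Times compact_Icc)
  show ?thesis
  proof (rule integrableI_bounded_set[of "{-R..R} \<times> {1..2}" _ _ "P * Q * H"])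
    show "{-R..R} \<times> {1..2} \<in> sets (lborel :: (real \<times> real) measure)"
      using compact_imp_closed[OF K] by simp
    show "emeasure lborel ({-R..R} \<times> {1..2::real}) < \<infinity>"
      using emeasure_compact_finite[OF K] by simp
    show "(\<lambda>z. (p (fst z) * q (snd z)) *\<^sub>R h (fst z / snd z)) \<in> borel_measurable lborel"
      unfolding lborel_prod[symmetric] by measurable
    have "norm ((p (fst z) * q (snd z)) *\<^sub>R h (fst z / snd z)) \<le> P * Q * H" for z
      unfolding norm_scaleR abs_mult
      using P Q by (intro mult_mono H mult_nonneg_nonneg) auto
    then show "AE z in lborel. z \<in> {-R..R} \<times> {1..2} \<longrightarrow>
        norm ((p (fst z) * q (snd z)) *\<^sub>R h (fst z / snd z)) \<le> P * Q * H"
      by simp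
    show "AE z in lborel. z \<notin> {-R..R} \<times> {1..2} \<longrightarrow>
        (p (fst z) * q (snd z)) *\<^sub>R h (fst z / snd z) = 0"
      using p0 q0 by (intro AE_I2) (auto simp: mem_Times_iff)
  qed
qed

lemma lborel_Fubini_snd:
  fixes g :: "real \<times> real \<Rightarrow> real"
  assumes "integrable lborel g"
  shows "(\<integral>t. (\<integral>x. g (x, t) \<partial>lborel) \<partial>lborel) = (\<integral>z. g z \<partial>lborel)"
  using lborel_pair.integral_snd[of "\<lambda>x t. g (x, t)"] assms by (simp add: lborel_prod)

lemma bounded_continuous_image:
  fixes g :: "'a::euclidean_space \<Rightarrow> 'b::metric_space"
  assumes "continuous_on UNIV g" and "bounded (range w)"
  shows "bounded (range (\<lambda>\<xi>. g (w \<xi>)))"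
proof -
  have "compact (g ` closure (range w))"
    using assms by (intro compact_continuous_image) (auto intro: continuous_on_subset)
  then show ?thesis
    by (rule bounded_subset[OF compact_imp_bounded]) (use closure_subset in fastforce)
qed

text \<open>The entropy \<open>U\<close> may be modified by the affine function \<open>u \<mapsto> c - \<langle>v, u\<rangle>\<close>, and \<open>F\<close> by
  \<open>d - \<langle>v, f(u)\<rangle>\<close>: the linear part adds a multiple of the weak equation, which holds with equality,
  and the constants integrate to zero against derivatives of a test function.\<close>

lemma self_similar_entropy_solution_tensor_ineq:
  fixes f :: "real^'m \<Rightarrow> real^'m" and w :: "real \<Rightarrow> real^'m"
  assumes cont: "continuous_on UNIV f" "continuous_on UNIV U" "continuous_on UNIV F"
    and [measurable]: "w \<in> borel_measurable borel" and bd: "bounded (range w)"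
    and weak: "weak_solution f (\<lambda>(x, t). w (x / t))"
    and entropy: "weak_entropy_ineq U F (\<lambda>(x, t). w (x / t))"
  shows "tensor_ineq (\<lambda>\<xi>. U (w \<xi>) - v \<bullet> w \<xi> + c) (\<lambda>\<xi>. F (w \<xi>) - v \<bullet> f (w \<xi>) + d)"
  unfolding tensor_ineq_def
proof (intro allI impI, elim conjE)
  fix \<rho> \<rho>' \<theta> \<theta>' :: "real \<Rightarrow> real" and R
  assume \<rho>: "smooth \<rho>" "\<forall>x. 0 \<le> \<rho> x" "\<forall>x. (\<rho> has_real_derivative \<rho>' x) (at x)"
    "\<forall>x. x \<notin> {-R..R} \<longrightarrow> \<rho> x = 0"
    and \<theta>: "smooth \<theta>" "\<forall>t. 0 \<le> \<theta> t" "\<forall>t. (\<theta> has_real_derivative \<theta>' t) (at t)"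
    "\<forall>t. t \<notin> {1..2} \<longrightarrow> \<theta> t = 0"
  have [measurable]: "f \<in> borel_measurable borel" "U \<in> borel_measurable borel" "F \<in> borel_measurable borel"
    using cont by (auto intro: borel_measurable_continuous_onI)
  have \<rho>'0: "\<rho>' x = 0" if "x \<notin> {-R..R}" for x
    using nonneg_zero_imp_DERIV_zero[of \<rho> "\<rho>' x" x] \<rho> that by blast
  have \<theta>'0: "\<theta>' t = 0" if "t \<notin> {1..2}" for t
    using nonneg_zero_imp_DERIV_zero[of \<theta> "\<theta>' t" t] \<theta> that by blast
  have c\<rho>: "continuous_on UNIV \<rho>" "continuous_on UNIV \<rho>'"
    using smooth_continuous[OF \<rho>(1)] smooth_DERIV_continuous[OF \<rho>(1)] \<rho>(3) by auto
  have c\<theta>: "continuous_on UNIV \<theta>" "continuous_on UNIV \<theta>'"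
    using smooth_continuous[OF \<theta>(1)] smooth_DERIV_continuous[OF \<theta>(1)] \<theta>(3) by auto
  have int_t: "integrable lborel (\<lambda>z. (\<rho> (fst z) * \<theta>' (snd z)) *\<^sub>R h (fst z / snd z))"
    and int_x: "integrable lborel (\<lambda>z. (\<rho>' (fst z) * \<theta> (snd z)) *\<^sub>R h (fst z / snd z))"
    if "h \<in> borel_measurable borel" "bounded (range h)" for h :: "real \<Rightarrow> 'b::euclidean_space"
    by (rule integrable_tensor[of _ _ R]; use that c\<rho> c\<theta> \<rho> \<theta> \<rho>'0 \<theta>'0 in blast)+
  let ?\<phi> = "\<lambda>p. \<rho> (fst p) * \<theta> (snd p)"
  have test: "test_function ?\<phi>"
    using tensor_test_function[of \<rho> \<theta> R] \<rho> \<theta> by blast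
  have dt: "dt ?\<phi> z = \<rho> (fst z) * \<theta>' (snd z)" and dx: "dx ?\<phi> z = \<rho>' (fst z) * \<theta> (snd z)" for z
    using tensor_has_derivative[of \<rho> \<rho>' \<theta> \<theta>' z] \<rho> \<theta> by simp_all
  have half: "indicator half_plane z *\<^sub>R (dt ?\<phi> z *\<^sub>R a + dx ?\<phi> z *\<^sub>R b)
      = (\<rho> (fst z) * \<theta>' (snd z)) *\<^sub>R a + (\<rho>' (fst z) * \<theta> (snd z)) *\<^sub>R b"
    for z and a b :: "'b::real_vector"
  proof (cases "z \<in> half_plane")
    case False
    then have "snd z \<notin> {1..2}" by (cases z) auto
    then show ?thesis using \<theta>(4) \<theta>'0 by (simp add: dt dx)
  qed (simp add: dt dx)
  \<comment> \<open>The integrands of the entropy inequality, of the weak equation and of the constants; the claim is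
    about \<open>e - \<langle>v, m\<rangle> + k\<close>.\<close>
  define e where "e z = (\<rho> (fst z) * \<theta>' (snd z)) *\<^sub>R U (w (fst z / snd z))
      + (\<rho>' (fst z) * \<theta> (snd z)) *\<^sub>R F (w (fst z / snd z))" for z
  define m where "m z = (\<rho> (fst z) * \<theta>' (snd z)) *\<^sub>R w (fst z / snd z)
      + (\<rho>' (fst z) * \<theta> (snd z)) *\<^sub>R f (w (fst z / snd z))" for z
  define k where "k z = (\<rho> (fst z) * \<theta>' (snd z)) *\<^sub>R c + (\<rho>' (fst z) * \<theta> (snd z)) *\<^sub>R d" for z
  have bounds: "bounded (range (\<lambda>\<xi>. U (w \<xi>)))" "bounded (range (\<lambda>\<xi>. F (w \<xi>)))"
    "bounded (range (\<lambda>\<xi>. f (w \<xi>)))"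
    using bounded_continuous_image[OF cont(2) bd] bounded_continuous_image[OF cont(3) bd]
      bounded_continuous_image[OF cont(1) bd] .
  have int_e: "integrable lborel e"
    unfolding e_def[abs_def]
    by (rule Bochner_Integration.integrable_add[OF int_t[of "\<lambda>\<xi>. U (w \<xi>)", OF _ bounds(1)]
          int_x[of "\<lambda>\<xi>. F (w \<xi>)", OF _ bounds(2)]]) measurable
  have int_m: "integrable lborel m"
    unfolding m_def[abs_def]
    by (rule Bochner_Integration.integrable_add[OF int_t[of w, OF _ bd]
          int_x[of "\<lambda>\<xi>. f (w \<xi>)", OF _ bounds(3)]]) measurable
  have int_k: "integrable lborel k"
    unfolding k_def[abs_def]
    by (rule Bochner_Integration.integrable_add[OF int_t[of "\<lambda>_. c"] int_x[of "\<lambda>_. d"]]) auto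
  have "0 \<le> (LINT p:half_plane|lborel. dt ?\<phi> p * U (case p of (x, t) \<Rightarrow> w (x / t))
      + dx ?\<phi> p * F (case p of (x, t) \<Rightarrow> w (x / t)))"
    using entropy test \<rho>(2) \<theta>(2) unfolding weak_entropy_ineq_def by simp
  also have "\<dots> = (\<integral>z. e z \<partial>lborel)"
    unfolding set_lebesgue_integral_def
  proof (rule Bochner_Integration.integral_cong[OF refl])
    show "indicator half_plane p *\<^sub>R (dt ?\<phi> p * U (case p of (x, t) \<Rightarrow> w (x / t))
        + dx ?\<phi> p * F (case p of (x, t) \<Rightarrow> w (x / t))) = e p" for p
      using half[of p "U (w (fst p / snd p))" "F (w (fst p / snd p))"] by (simp add: e_def split_beta)
  qed
  finally have E: "0 \<le> (\<integral>z. e z \<partial>lborel)" .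
  have "0 = (LINT p:half_plane|lborel. dt ?\<phi> p *\<^sub>R (case p of (x, t) \<Rightarrow> w (x / t))
      + dx ?\<phi> p *\<^sub>R f (case p of (x, t) \<Rightarrow> w (x / t)))"
    using weak test unfolding weak_solution_def by simp
  also have "\<dots> = (\<integral>z. m z \<partial>lborel)"
    unfolding set_lebesgue_integral_def
  proof (rule Bochner_Integration.integral_cong[OF refl])
    show "indicator half_plane p *\<^sub>R (dt ?\<phi> p *\<^sub>R (case p of (x, t) \<Rightarrow> w (x / t))
        + dx ?\<phi> p *\<^sub>R f (case p of (x, t) \<Rightarrow> w (x / t))) = m p" for p
      unfolding half m_def by (simp add: split_beta)
  qed
  finally have "(\<integral>z. m z \<partial>lborel) = 0" by simp
  then have M: "(\<integral>z. v \<bullet> m z \<partial>lborel) = 0"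
    using int_m by simp
  have "(\<integral>z. k z \<partial>lborel) = (\<integral>t. (\<integral>x. k (x, t) \<partial>lborel) \<partial>lborel)"
    by (rule lborel_Fubini_snd[OF int_k, symmetric])
  also have "\<dots> = (\<integral>t. \<theta>' t * (c * (\<integral>x. \<rho> x \<partial>lborel)) \<partial>lborel)"
  proof -
    have i: "integrable lborel \<rho>" "integrable lborel \<rho>'"
    proof -
      obtain P where "\<And>x. \<bar>\<rho> x\<bar> \<le> P"
        by (rule continuous_compact_support_bounded[of "-R" R \<rho>])
          (use c\<rho> \<rho>(4) in \<open>auto intro: continuous_on_subset\<close>)
      with c\<rho> \<rho>(4) show "integrable lborel \<rho>"
        by (intro integrable_bounded_support[of _ P "-R" R]) (auto intro: borel_measurable_continuous_onI)
      obtain P where "\<And>x. \<bar>\<rho>' x\<bar> \<le> P"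
        by (rule continuous_compact_support_bounded[of "-R" R \<rho>'])
          (use c\<rho> \<rho>'0 in \<open>auto intro: continuous_on_subset\<close>)
      with c\<rho> \<rho>'0 show "integrable lborel \<rho>'"
        by (intro integrable_bounded_support[of _ P "-R" R]) (auto intro: borel_measurable_continuous_onI)
    qed
    have "(\<integral>x. \<rho>' x \<partial>lborel) = \<rho> (\<bar>R\<bar> + 1) - \<rho> (- (\<bar>R\<bar> + 1))"
    proof (rule integral_derivative_compact_support[where G = \<rho>])
      show "\<rho>' x = 0" if "x \<notin> {- (\<bar>R\<bar> + 1)..\<bar>R\<bar> + 1}" for x
        using that by (intro \<rho>'0) auto
    qed (use \<rho>(3) c\<rho> in auto)
    moreover have "\<rho> (\<bar>R\<bar> + 1) = 0" "\<rho> (- (\<bar>R\<bar> + 1)) = 0"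
      by (rule \<rho>(4)[rule_format], auto)+
    ultimately have "(\<integral>x. \<rho>' x \<partial>lborel) = 0" by simp
    then show ?thesis
      by (simp add: k_def i mult.commute mult.left_commute)
  qed
  also have "(\<integral>t. \<theta>' t * (c * (\<integral>x. \<rho> x \<partial>lborel)) \<partial>lborel) = 0"
  proof -
    have "(\<integral>t. \<theta>' t \<partial>lborel) = \<theta> 3 - \<theta> 0"
    proof (rule integral_derivative_compact_support[where G = \<theta>])
      show "\<theta>' t = 0" if "t \<notin> {0..3}" for t
        using that by (intro \<theta>'0) auto
    qed (use \<theta>(3) c\<theta> in auto)
    then show ?thesis using \<theta>(4) by simp
  qed
  finally have k: "(\<integral>z. k z \<partial>lborel) = 0" .
  have "0 \<le> (\<integral>z. e z - v \<bullet> m z + k z \<partial>lborel)"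
    using E M k int_e int_m int_k by simp
  also have "\<dots> = (\<integral>t. (\<integral>x. e (x, t) - v \<bullet> m (x, t) + k (x, t) \<partial>lborel) \<partial>lborel)"
    by (rule lborel_Fubini_snd[symmetric]) (use int_e int_m int_k in simp)
  also have "\<dots> = (\<integral>t. (\<integral>x. \<theta>' t * \<rho> x * (U (w (x / t)) - v \<bullet> w (x / t) + c)
      + \<theta> t * \<rho>' x * (F (w (x / t)) - v \<bullet> f (w (x / t)) + d) \<partial>lborel) \<partial>lborel)"
    by (simp add: e_def m_def k_def inner_add_right algebra_simps)
  finally show "0 \<le> (\<integral>t. (\<integral>x. \<theta>' t * \<rho> x * (U (w (x / t)) - v \<bullet> w (x / t) + c)
      + \<theta> t * \<rho>' x * (F (w (x / t)) - v \<bullet> f (w (x / t)) + d) \<partial>lborel) \<partial>lborel)" .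
qed

text \<open>For \<open>z = u\<^sub>r\<close> and \<open>z = u\<^sub>l\<close>, subtract from \<open>U\<close> its tangent at \<open>z\<close>. The resulting entropy
  \<open>A z\<close> is nonnegative, and it and its flux \<open>B z\<close> vanish at \<open>z\<close>, hence on the far side of the waves. Thus
  \<open>B z\<close> has a sign at \<open>\<xi> = 0\<close>, which is the condition at the interface.\<close>

lemma godunov_stable:
  fixes f :: "real^'m \<Rightarrow> real^'m"
  assumes f: "smooth f" and ep: "entropy_pair f U F" and rs: "riemann_solution f U F uR"
  shows "entropy_stable_interface f U F ul ur (godunov_flux f uR ul ur) (godunov_entropy_flux F uR ul ur)"
proof -
  have U: "smooth U" and F: "smooth F" and pd: "\<And>x. pos_def (hessian U x)"
    using ep by (auto simp: entropy_pair_def)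
  have cont: "continuous_on UNIV f" "continuous_on UNIV U" "continuous_on UNIV F"
    using smooth_continuous f U F by blast+
  define w where "w \<xi> = uR \<xi> ul ur" for \<xi>
  have bd: "bounded (range w)" and w[measurable]: "w \<in> borel_measurable borel"
    and weak: "weak_solution f (\<lambda>(x, t). w (x / t))"
    and entropy: "weak_entropy_ineq U F (\<lambda>(x, t). w (x / t))"
    and far: "\<exists>M. (\<forall>\<xi>\<le>-M. w \<xi> = ul) \<and> (\<forall>\<xi>\<ge>M. w \<xi> = ur)"
    and lim: "(w \<longlongrightarrow> w 0) (at_left 0) \<or> (w \<longlongrightarrow> w 0) (at_right 0)"
    using rs unfolding riemann_solution_def w_def[abs_def] by blast+
  obtain M where M: "\<And>\<xi>. \<xi> \<le> - M \<Longrightarrow> w \<xi> = ul" "\<And>\<xi>. M \<le> \<xi> \<Longrightarrow> w \<xi> = ur"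
    using far by blast
  define A where "A z u = U u - grad U z \<bullet> u + (grad U z \<bullet> z - U z)" for z u
  define B where "B z u = F u - grad U z \<bullet> f u + (grad U z \<bullet> f z - F z)" for z u
  have ineq: "tensor_ineq (\<lambda>\<xi>. A z (w \<xi>)) (\<lambda>\<xi>. B z (w \<xi>))" for z
    unfolding A_def B_def
    by (rule self_similar_entropy_solution_tensor_ineq[OF cont w bd weak entropy])
  have A0: "0 \<le> A z u" for z u
    using convex_tangent_below[OF U pd, of z u] by (simp add: A_def inner_diff_right)
  have zero: "A z z = 0" "B z z = 0" for z by (simp_all add: A_def B_def)
  have cA: "continuous_on UNIV (A z)" and cB: "continuous_on UNIV (B z)" for z
    unfolding A_def[abs_def] B_def[abs_def] using cont by (auto intro!: continuous_intros)
  have [measurable]: "A z \<in> borel_measurable borel" "B z \<in> borel_measurable borel" for z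
    using cA cB by (auto intro: borel_measurable_continuous_onI)
  have bound: "\<exists>K. \<forall>\<xi>. \<bar>A z (w \<xi>)\<bar> \<le> K \<and> \<bar>B z (w \<xi>)\<bar> \<le> K" for z
  proof -
    obtain K1 K2 where "\<And>\<xi>. \<bar>A z (w \<xi>)\<bar> \<le> K1" "\<And>\<xi>. \<bar>B z (w \<xi>)\<bar> \<le> K2"
      using bounded_continuous_image[OF cA bd, of z] bounded_continuous_image[OF cB bd, of z]
      by (auto simp: bounded_iff)
    then show ?thesis by (intro exI[of _ "max K1 K2"]) (auto simp: le_max_iff_disj)
  qed
  have limB: "((\<lambda>\<xi>. B z (w \<xi>)) \<longlongrightarrow> B z (w 0)) (at_left 0)
      \<or> ((\<lambda>\<xi>. B z (w \<xi>)) \<longlongrightarrow> B z (w 0)) (at_right 0)" for z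
    using lim cB[of z] by (auto simp: continuous_on_eq_continuous_at intro: isCont_tendsto_compose)
  have "0 \<le> B ur (w 0)"
  proof -
    obtain K where K: "\<And>\<xi>. \<bar>A ur (w \<xi>)\<bar> \<le> K" "\<And>\<xi>. \<bar>B ur (w \<xi>)\<bar> \<le> K"
      using bound by blast
    show ?thesis
      by (rule tensor_ineq_trace_nonneg[OF _ _ K A0 _ limB ineq, of M]) (auto simp: M zero)
  qed
  moreover have "0 \<le> - B ul (w 0)"
  proof -
    obtain K where K: "\<And>\<xi>. \<bar>A ul (w \<xi>)\<bar> \<le> K" "\<And>\<xi>. \<bar>B ul (w \<xi>)\<bar> \<le> K"
      using bound by blast
    have "((\<lambda>\<xi>. - B ul (w (- \<xi>))) \<longlongrightarrow> - B ul (w 0)) (at_left 0)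
        \<or> ((\<lambda>\<xi>. - B ul (w (- \<xi>))) \<longlongrightarrow> - B ul (w 0)) (at_right 0)"
      using limB[of ul] filterlim_at_left_to_right[of "\<lambda>\<xi>. B ul (w \<xi>)" _ 0]
        filterlim_at_left_to_right[of "\<lambda>\<xi>. B ul (w (- \<xi>))" _ 0]
      by (auto intro!: tendsto_minus)
    from tensor_ineq_trace_nonneg[OF _ _ _ _ A0 _ this tensor_ineq_reflect[OF ineq], of K M]
    show ?thesis using K M by (auto simp: zero)
  qed
  ultimately show ?thesis
    unfolding entropy_stable_interface_def godunov_flux_def godunov_entropy_flux_def
      entropy_potential_def w_def B_def by simp
qed

section \<open>The cell entropy inequality\<close>

theorem theorem1:
  fixes f :: "real^'m \<Rightarrow> real^'m"
    and U F :: "real^'m \<Rightarrow> real"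
    and uR :: "real \<Rightarrow> real^'m \<Rightarrow> real^'m \<Rightarrow> real^'m"
    and \<Delta> :: real
    and \<alpha> :: "int \<Rightarrow> real \<Rightarrow> real"
    and I :: "real set"
    and u :: "int \<Rightarrow> real \<Rightarrow> real^'m"
  assumes "smooth f"
    and "entropy_pair f U F"
    and "convex (range (grad U))"
    and "riemann_solution f U F uR"
    and "\<Delta> > 0"
    and "is_interval I" and "interior I \<noteq> {}"
    and "\<And>k t. t \<in> I \<Longrightarrow> \<alpha> k t \<in> {0..1}"
    and "gt_scheme_solution f U uR \<Delta> \<alpha> I u"
  shows "\<forall>k. \<forall>t\<in>I. \<exists>D. ((\<lambda>s. U (u k s)) has_real_derivative D) (at t within I) \<and>
    D \<le> (gt_entropy_flux f U F uR (\<alpha> (k - 1) t) (u (k - 1) t) (u k t)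
          - gt_entropy_flux f U F uR (\<alpha> k t) (u k t) (u (k + 1) t)) / \<Delta>"
proof (intro allI ballI)
  fix k t assume t: "t \<in> I"
  have U: "smooth U" using assms(2) by (simp add: entropy_pair_def)
  have stable: "entropy_stable_interface f U F ul ur
      (gt_flux f U uR (\<alpha> j t) ul ur) (gt_entropy_flux f U F uR (\<alpha> j t) ul ur)" for j ul ur
    unfolding gt_flux_def gt_entropy_flux_def
    using assms t by (intro entropy_stable_interface_convex_combination godunov_stable tadmor_stable)
  define g1 where "g1 = gt_flux f U uR (\<alpha> (k - 1) t) (u (k - 1) t) (u k t)"
  define g2 where "g2 = gt_flux f U uR (\<alpha> k t) (u k t) (u (k + 1) t)"
  define v where "v = grad U (u k t)"
  have "(u k has_derivative (\<lambda>h. h *\<^sub>R ((g1 - g2) /\<^sub>R \<Delta>))) (at t within I)"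
    using assms(9) t by (simp add: gt_scheme_solution_def has_vector_derivative_def g1_def g2_def)
  from has_derivative_compose[OF this smooth_has_derivative_grad[OF U]]
  have "((\<lambda>s. U (u k s)) has_real_derivative (v \<bullet> (g1 - g2)) / \<Delta>) (at t within I)"
    unfolding has_field_derivative_def v_def
    by (rule has_derivative_eq_rhs) (simp add: fun_eq_iff divide_inverse mult_ac)
  \<comment> \<open>Cell \<open>k\<close> is the right neighbour of interface \<open>k - 1\<close> and the left neighbour of interface \<open>k\<close>;
    both conditions refer to the same potential \<open>\<psi>(u k t)\<close>.\<close>
  moreover have "v \<bullet> (g1 - g2) \<le> gt_entropy_flux f U F uR (\<alpha> (k - 1) t) (u (k - 1) t) (u k t)
      - gt_entropy_flux f U F uR (\<alpha> k t) (u k t) (u (k + 1) t)"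
    using stable[of "u (k - 1) t" "u k t" "k - 1"] stable[of "u k t" "u (k + 1) t" k]
    unfolding entropy_stable_interface_def g1_def g2_def v_def by (simp add: inner_diff_right)
  ultimately show "\<exists>D. ((\<lambda>s. U (u k s)) has_real_derivative D) (at t within I) \<and>
    D \<le> (gt_entropy_flux f U F uR (\<alpha> (k - 1) t) (u (k - 1) t) (u k t)
          - gt_entropy_flux f U F uR (\<alpha> k t) (u k t) (u (k + 1) t)) / \<Delta>"
    using assms(5) by (intro exI[of _ "(v \<bullet> (g1 - g2)) / \<Delta>"]) (simp add: divide_right_mono)
qed

end
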